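(* Let $n\geq 3$, $q=\lfloor n/3\rfloor$ and $r=n-3q$. Suppose the preference order $\sigma\in\{\pm1\}^n$ is chosen uniformly at random (equivalently, each diner independently prefers left or right with probability $1/2$), and the ma\^{i}tre d' seats the diners using the clairvoyant trap setting strategy (Algorithm $\mathcal{C}$ described in the context). Then: (1) The probability that exactly $k$ diners are napkinless is $p_{n,k}/2^n$, where \[ p_{n,k}=\begin{cases} 4\binom{n}{k} & \text{if } 0\leq k<q,\\[2pt] 2^n-4\sum_{i=0}^{q-1}\binom{n}{i} & \text{if } k=q,\\[2pt] 0 & \text{otherwise.}\end{cases} \] (2) The expected number of napkinless diners is \[ E_n=q-\frac{1}{2^{n-2}}\sum_{k=0}^{q-1}(q-k)\binom{n}{k}, \] and $E_n\to \lfloor n/3\rfloor$ as $n\to\infty$ (in the sense that $E_n-\lfloor n/3\rfloor\to 0$). (3) The strategy is optimal: for every preference order $\sigma\in\{\pm1\}^n$, the number of napkinless diners in the arrangement produced by Algorithm $\mathcal{C}$ equals $\nu_{\max}(\sigma)$, the maximum number of napkinless diners over all seating orders.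
   Context: Napkin problem. A circular table has $n$ seats labelled $1,\dots,n$ (indices mod $n$), seat $i+1$ being immediately to the right of seat $i$. Between seats $i$ and $i+1$ lies napkin $N_i$, so the diner in seat $i$ has left napkin $N_{i-1}$ and right napkin $N_i$. Diners labelled $1,\dots,n$ are seated one at a time in the order $1,2,\dots,n$. A preference order is $\sigma=(\sigma_1,\dots,\sigma_n)\in\{\pm1\}^n$: $\sigma_j=+1$ means Diner $j$ prefers the right napkin, $\sigma_j=-1$ the left napkin. When Diner $j$ sits, they take their preferred napkin if it is unclaimed; otherwise they take their other adjacent napkin if unclaimed; otherwise they take no napkin and are called napkinless. A seating order is a permutation $w=(w_1,\dots,w_n)$ of $\{1,\dots,n\}$ with $w_1=1$, where $w_i=j$ means Diner $j$ sits in Seat $i$. $\nu(w,\sigma)$ denotes the number of napkinless diners, and $\nu_{\max}(\sigma)=\max_w \nu(w,\sigma)$. The ma\^{i}tre d' learns $\sigma_i$ only when Diner $i$ is about to be seated (after Diners $1,\dots,i-1$ have been placed). Algorithm $\mathcal{C}$ (clairvoyant trap setting). Write $n=3q+r$ with $q=\lfloor n/3\rfloor$. For $1\le j\le q$, bench $B_j$ consists of seats $3j-2$ (leftmost), $3j-1$ (centre), $3j$ (rightmost); seats $3q+1,\dots,n$ are remainder seats. At any stage a bench $B_j$ is primed if its leftmost and rightmost seats are assigned and its centre seat is not; each unassigned remainder seat also counts as a primed bench, ordered after $B_1,\dots,B_q$ and from left to right. For $i=1,\dots,n$, on learning $\sigma_i$: (1) if $\sigma_i=+1$: (a) if some bench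 has an unassigned leftmost seat, assign Diner $i$ to the leftmost seat of the lowest-numbered such bench; (b) else if a primed bench exists, assign Diner $i$ to the lowest-numbered primed bench (its centre seat, or the leftmost unassigned remainder seat if it is a remainder seat); (c) else assign Diner $i$ to the rightmost seat of the lowest-numbered bench possible. (2) if $\sigma_i=-1$: (a) if some bench has an unassigned rightmost seat, assign Diner $i$ to the rightmost seat of the lowest-numbered such bench; (b) else if a primed bench exists, assign Diner $i$ to the lowest-numbered primed bench (centre seat, or leftmost unassigned remainder seat); (c) else assign Diner $i$ to the leftmost seat of the lowest-numbered bench possible. The resulting assignment (with seat labels rotated so that Diner 1 is in Seat 1, which does not affect who is napkinless) is the seating produced by the strategy. *)

theory Defs
  imports "HOL-Probability.Probability"
begin

section \<open>The napkin process\<close>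

text \<open>
  Seats, diners and napkins are all numbered \<open>1, \<dots>, n\<close>.  Napkin \<open>i\<close> lies between seat \<open>i\<close> and the
  seat to its right, so napkin \<open>n\<close> plays the role of \<open>N\<^sub>0\<close>.
\<close>

definition left_napkin :: "nat \<Rightarrow> nat \<Rightarrow> nat" where
  "left_napkin n i = (if i = 1 then n else i - 1)"

definition right_napkin :: "nat \<Rightarrow> nat" where
  "right_napkin i = i"

definition preference_orders :: "nat \<Rightarrow> (nat \<Rightarrow> int) set" where
  "preference_orders n = {1..n} \<rightarrow>\<^sub>E {1, -1}"

text \<open>For a seating order \<open>w\<close>, the diner in seat \<open>i\<close> is \<open>w i\<close>, so diner \<open>j\<close> sits in seat \<open>inv w j\<close>.\<close>

definition seating_orders :: "nat \<Rightarrow> (nat \<Rightarrow> nat) set" where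
  "seating_orders n = {w. w permutes {1..n} \<and> w 1 = 1}"

definition preferred_napkin :: "nat \<Rightarrow> (nat \<Rightarrow> nat) \<Rightarrow> (nat \<Rightarrow> int) \<Rightarrow> nat \<Rightarrow> nat" where
  "preferred_napkin n w \<sigma> j =
     (if \<sigma> j = 1 then right_napkin (inv w j) else left_napkin n (inv w j))"

definition other_napkin :: "nat \<Rightarrow> (nat \<Rightarrow> nat) \<Rightarrow> (nat \<Rightarrow> int) \<Rightarrow> nat \<Rightarrow> nat" where
  "other_napkin n w \<sigma> j =
     (if \<sigma> j = 1 then left_napkin n (inv w j) else right_napkin (inv w j))"

text \<open>The set of napkins claimed once diners \<open>1, \<dots>, j\<close> have been seated.\<close>

fun claimed :: "nat \<Rightarrow> (nat \<Rightarrow> nat) \<Rightarrow> (nat \<Rightarrow> int) \<Rightarrow> nat \<Rightarrow> nat set" where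
  "claimed n w \<sigma> 0 = {}"
| "claimed n w \<sigma> (Suc j) =
     (let C = claimed n w \<sigma> j;
          p = preferred_napkin n w \<sigma> (Suc j);
          p' = other_napkin n w \<sigma> (Suc j)
      in if p \<notin> C then insert p C
         else if p' \<notin> C then insert p' C
         else C)"

definition napkinless :: "nat \<Rightarrow> (nat \<Rightarrow> nat) \<Rightarrow> (nat \<Rightarrow> int) \<Rightarrow> nat \<Rightarrow> bool" where
  "napkinless n w \<sigma> j \<longleftrightarrow>
     preferred_napkin n w \<sigma> j \<in> claimed n w \<sigma> (j - 1) \<and>
     other_napkin n w \<sigma> j \<in> claimed n w \<sigma> (j - 1)"

definition \<nu> :: "nat \<Rightarrow> (nat \<Rightarrow> nat) \<Rightarrow> (nat \<Rightarrow> int) \<Rightarrow> nat" where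
  "\<nu> n w \<sigma> = card {j \<in> {1..n}. napkinless n w \<sigma> j}"

definition \<nu>_max :: "nat \<Rightarrow> (nat \<Rightarrow> int) \<Rightarrow> nat" where
  "\<nu>_max n \<sigma> = Max ((\<lambda>w. \<nu> n w \<sigma>) ` seating_orders n)"


section \<open>The clairvoyant trap setting strategy\<close>

text \<open>
  Below, \<open>A\<close> is the set of seats already assigned.  Since the benches \<open>B\<^sub>1, \<dots>, B\<^sub>q\<close> and then the
  remainder seats appear in the order of their seat numbers, choosing the lowest-numbered
  (primed) bench amounts to choosing the least seat among the corresponding candidates.
\<close>

definition free_leftmost :: "nat \<Rightarrow> nat set \<Rightarrow> nat set" where
  "free_leftmost n A = {3 * j - 2 | j. j \<in> {1..n div 3} \<and> 3 * j - 2 \<notin> A}"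

definition free_rightmost :: "nat \<Rightarrow> nat set \<Rightarrow> nat set" where
  "free_rightmost n A = {3 * j | j. j \<in> {1..n div 3} \<and> 3 * j \<notin> A}"

text \<open>The centre seats of primed benches together with the unassigned remainder seats.\<close>

definition primed_seats :: "nat \<Rightarrow> nat set \<Rightarrow> nat set" where
  "primed_seats n A =
     {3 * j - 1 | j. j \<in> {1..n div 3} \<and> 3 * j - 2 \<in> A \<and> 3 * j \<in> A \<and> 3 * j - 1 \<notin> A} \<union>
     ({3 * (n div 3) + 1..n} - A)"

definition next_seat :: "nat \<Rightarrow> nat set \<Rightarrow> int \<Rightarrow> nat" where
  "next_seat n A s =
     (if s = 1 then
        (if free_leftmost n A \<noteq> {} then Min (free_leftmost n A)
         else if primed_seats n A \<noteq> {} then Min (primed_seats n A)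
         else Min (free_rightmost n A))
      else
        (if free_rightmost n A \<noteq> {} then Min (free_rightmost n A)
         else if primed_seats n A \<noteq> {} then Min (primed_seats n A)
         else Min (free_leftmost n A)))"

fun assigned_seats :: "nat \<Rightarrow> (nat \<Rightarrow> int) \<Rightarrow> nat \<Rightarrow> nat set" where
  "assigned_seats n \<sigma> 0 = {}"
| "assigned_seats n \<sigma> (Suc i) =
     insert (next_seat n (assigned_seats n \<sigma> i) (\<sigma> (Suc i))) (assigned_seats n \<sigma> i)"

definition trap_seat :: "nat \<Rightarrow> (nat \<Rightarrow> int) \<Rightarrow> nat \<Rightarrow> nat" where
  "trap_seat n \<sigma> i = next_seat n (assigned_seats n \<sigma> (i - 1)) (\<sigma> i)"

text \<open>The seat of diner \<open>i\<close> after rotating the labels so that diner 1 is in seat 1.\<close>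

definition rotated_trap_seat :: "nat \<Rightarrow> (nat \<Rightarrow> int) \<Rightarrow> nat \<Rightarrow> nat" where
  "rotated_trap_seat n \<sigma> i = (trap_seat n \<sigma> i + n - trap_seat n \<sigma> 1) mod n + 1"

definition trap_seating :: "nat \<Rightarrow> (nat \<Rightarrow> int) \<Rightarrow> nat \<Rightarrow> nat" where
  "trap_seating n \<sigma> i =
     (if i \<in> {1..n} then inv_into {1..n} (rotated_trap_seat n \<sigma>) i else i)"


section \<open>The distribution of the number of napkinless diners\<close>

definition random_preference_order :: "nat \<Rightarrow> (nat \<Rightarrow> int) pmf" where
  "random_preference_order n = pmf_of_set (preference_orders n)"

definition expected_napkinless :: "nat \<Rightarrow> real" where
  "expected_napkinless n =
     measure_pmf.expectation (random_preference_order n) (\<lambda>\<sigma>. real (\<nu> n (trap_seating n \<sigma>) \<sigma>))"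

definition napkinless_count :: "nat \<Rightarrow> nat \<Rightarrow> real" where
  "napkinless_count n k =
     (if k < n div 3 then 4 * real (n choose k)
      else if k = n div 3 then 2 ^ n - 4 * (\<Sum>i<n div 3. real (n choose i))
      else 0)"


section \<open>The strategy produces a seating order\<close>

lemma primed_seats_not_assigned: "primed_seats n A \<inter> A = {}"
  and free_leftmost_not_assigned: "free_leftmost n A \<inter> A = {}"
  and free_rightmost_not_assigned: "free_rightmost n A \<inter> A = {}"
  by (auto simp: primed_seats_def free_leftmost_def free_rightmost_def)

lemma primed_seats_subset: "primed_seats n A \<subseteq> {1..n}"
  and free_leftmost_subset: "free_leftmost n A \<subseteq> {1..n}"
  and free_rightmost_subset: "free_rightmost n A \<subseteq> {1..n}"
  by (auto simp: primed_seats_def free_leftmost_def free_rightmost_def)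

lemma some_seat_free:
  assumes "x \<in> {1..n}" "x \<notin> A"
  shows "free_leftmost n A \<union> primed_seats n A \<union> free_rightmost n A \<noteq> {}"
proof (cases "x > 3 * (n div 3)")
  case True
  then have "x \<in> primed_seats n A"
    using assms by (auto simp: primed_seats_def)
  then show ?thesis by blast
next
  case False
  define j where "j = (x + 2) div 3"
  have j: "j \<in> {1..n div 3}"
    using False assms unfolding j_def by auto
  have "x = 3 * j - 2 \<or> x = 3 * j - 1 \<or> x = 3 * j"
    using assms unfolding j_def by auto
  then show ?thesis
    using j assms(2)
    by (auto simp: primed_seats_def free_leftmost_def free_rightmost_def)
qed

lemma next_seat_free:
  assumes "x \<in> {1..n}" "x \<notin> A"
  shows "next_seat n A s \<in> {1..n} - A"
proof -
  have *: "Min S \<in> {1..n} - A" if "S \<noteq> {}" "S \<subseteq> {1..n}" "S \<inter> A = {}" for S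
    using that Min_in[of S] finite_subset[of S "{1..n}"] by blast
  have L: "free_leftmost n A \<noteq> {} \<Longrightarrow> Min (free_leftmost n A) \<in> {1..n} - A"
    by (rule *[OF _ free_leftmost_subset free_leftmost_not_assigned])
  have P: "primed_seats n A \<noteq> {} \<Longrightarrow> Min (primed_seats n A) \<in> {1..n} - A"
    by (rule *[OF _ primed_seats_subset primed_seats_not_assigned])
  have R: "free_rightmost n A \<noteq> {} \<Longrightarrow> Min (free_rightmost n A) \<in> {1..n} - A"
    by (rule *[OF _ free_rightmost_subset free_rightmost_not_assigned])
  show ?thesis
    using some_seat_free[OF assms] L P R unfolding next_seat_def by auto
qed

lemma assigned_seats_card:
  "i \<le> n \<Longrightarrow> assigned_seats n \<sigma> i \<subseteq> {1..n} \<and> card (assigned_seats n \<sigma> i) = i"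
proof (induction i)
  case (Suc i)
  define A where "A = assigned_seats n \<sigma> i"
  have A: "A \<subseteq> {1..n}" "card A = i" using Suc by (auto simp: A_def)
  then have fin: "finite A" using finite_subset by blast
  have "A \<noteq> {1..n}" using A Suc.prems by auto
  then obtain x where "x \<in> {1..n}" "x \<notin> A" using A by blast
  from next_seat_free[OF this, of "\<sigma> (Suc i)"]
  have "next_seat n A (\<sigma> (Suc i)) \<in> {1..n} - A" .
  then show ?case using A fin by (simp add: A_def[symmetric])
qed simp

lemma assigned_seats_eq: "assigned_seats n \<sigma> i = trap_seat n \<sigma> ` {1..i}"
  by (induction i) (auto simp: trap_seat_def atLeastAtMostSuc_conv)

lemma bij_betw_trap_seat: "bij_betw (trap_seat n \<sigma>) {1..n} {1..n}"
proof -
  have im: "trap_seat n \<sigma> ` {1..n} = assigned_seats n \<sigma> n"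
    by (simp add: assigned_seats_eq)
  have "assigned_seats n \<sigma> n \<subseteq> {1..n}" "card (assigned_seats n \<sigma> n) = n"
    using assigned_seats_card[of n n \<sigma>] by auto
  then show ?thesis
    unfolding bij_betw_def im
    by (metis card_atLeastAtMost card_subset_eq diff_Suc_1 eq_card_imp_inj_on
        finite_atLeastAtMost im)
qed

lemma bij_betw_rotated_trap_seat:
  assumes "n \<ge> 1"
  shows "bij_betw (rotated_trap_seat n \<sigma>) {1..n} {1..n}"
proof -
  define c where "c = trap_seat n \<sigma> 1"
  have c: "c \<in> {1..n}"
    using bij_betw_apply[OF bij_betw_trap_seat, of 1 n \<sigma>] assms by (auto simp: c_def)
  have inj: "inj_on (\<lambda>x. (x + n - c) mod n + 1) {1..n}"
  proof (rule inj_onI)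
    fix x y assume xy: "x \<in> {1..n}" "y \<in> {1..n}" "(x + n - c) mod n + 1 = (y + n - c) mod n + 1"
    have "(z + n - c) mod n = (if z \<ge> c then z - c else z + n - c)" if "z \<in> {1..n}" for z
    proof (cases "z \<ge> c")
      case True
      then have "z + n - c = (z - c) + n" by simp
      then have "(z + n - c) mod n = (z - c) mod n" by (metis mod_add_self2)
      then show ?thesis using True that c by auto
    next
      case False
      then show ?thesis using that c by auto
    qed
    then show "x = y" using xy c by (auto split: if_splits)
  qed
  have "(\<lambda>x. (x + n - c) mod n + 1) ` {1..n} \<subseteq> {1..n}"
    using assms by (auto simp: Suc_le_eq)
  then have "bij_betw (\<lambda>x. (x + n - c) mod n + 1) {1..n} {1..n}"
    using inj by (simp add: bij_betw_def endo_inj_surj)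
  from bij_betw_trans[OF bij_betw_trap_seat this] show ?thesis
    by (rule iffD1[OF bij_betw_cong, rotated]) (simp add: rotated_trap_seat_def c_def)
qed

lemma trap_seating_in_seating_orders:
  assumes "n \<ge> 1"
  shows "trap_seating n \<sigma> \<in> seating_orders n"
proof -
  note b = bij_betw_rotated_trap_seat[OF assms, of \<sigma>]
  have "bij_betw (trap_seating n \<sigma>) {1..n} {1..n}"
    using bij_betw_cong[of "{1..n}" "trap_seating n \<sigma>" "inv_into {1..n} (rotated_trap_seat n \<sigma>)"]
      bij_betw_inv_into[OF b] by (simp add: trap_seating_def)
  then have perm: "trap_seating n \<sigma> permutes {1..n}"
    by (rule bij_imp_permutes) (auto simp: trap_seating_def)
  have "rotated_trap_seat n \<sigma> 1 = 1"
    by (simp add: rotated_trap_seat_def)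
  then have "trap_seating n \<sigma> 1 = 1"
    using assms b inv_into_f_f[of "rotated_trap_seat n \<sigma>" "{1..n}" 1]
    by (auto simp: trap_seating_def bij_betw_def)
  with perm show ?thesis by (simp add: seating_orders_def)
qed

end

theory Submission
  imports Defs
begin

text \<open>
  Let \<open>S\<^sub>t\<close> be the sum of the first \<open>t\<close> preferences.  The two neighbours of a napkinless diner took a
  left and a right napkin, so \<open>3 \<nu> \<le> n\<close>.  Moreover a diner who took the left napkin either
  prefers it or found the right one taken by a neighbour who also took the left napkin; counting
  these displacements up to time \<open>t\<close> gives \<open>2 \<nu> + \<bar>S\<^sub>t\<bar> \<le> n\<close> for every seating and every \<open>t\<close>.
  Algorithm C loses a trap only when all benches on one side are filled and none is primed, which
  determines \<open>S\<^sub>t\<close> at the last such moment; hence it reaches \<open>\<nu> = \<lfloor>n/3\<rfloor>\<close> or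
  \<open>2 \<nu> + \<bar>S\<^sub>t\<bar> \<ge> n - 1\<close> for some \<open>t\<close>.  It is therefore optimal, and for \<open>k < \<lfloor>n/3\<rfloor>\<close> the event
  \<open>\<nu> \<le> k\<close> says that the walk \<open>S\<close> reaches distance \<open>n - 1 - 2 k\<close> from \<open>0\<close>.  Walks of length \<open>n\<close> that
  reach \<open>n - 1 - 2 k\<close> obey Pascal's recursion in the first step.
\<close>

section \<open>Upper bound for arbitrary seatings\<close>

lemma sum_preferences:
  assumes "\<sigma> \<in> preference_orders n" "t \<le> n"
  shows "(\<Sum>i=1..t. \<sigma> i) = int (card {i\<in>{1..t}. \<sigma> i = 1}) - int (card {i\<in>{1..t}. \<sigma> i \<noteq> 1})"
  using assms(2)
proof (induction t)
  case (Suc t)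
  have "\<sigma> (Suc t) = 1 \<or> \<sigma> (Suc t) = -1"
    using assms(1) Suc.prems by (auto simp: preference_orders_def PiE_iff)
  moreover have "{i\<in>{1..Suc t}. Q i} = (if Q (Suc t) then insert (Suc t) {i\<in>{1..t}. Q i} else {i\<in>{1..t}. Q i})"
    for Q by (auto simp: le_Suc_eq)
  ultimately show ?case using Suc by auto
qed simp

section \<open>Napkin claiming in the abstract\<close>

text \<open>\<open>L j\<close> and \<open>R j\<close> are the two napkins beside diner
  \<open>j\<close>, and \<open>P j\<close> says that \<open>j\<close> prefers \<open>R j\<close>.
  Geometry enters only through the injectivity of \<open>L\<close> and \<open>R\<close>, so swapping
  them while negating \<open>P\<close> gives another instance and each one-sided estimate is proved
  once.\<close>

locale claim_process =
  fixes n :: nat and L R :: "nat \<Rightarrow> nat" and P :: "nat \<Rightarrow> bool" and C :: "nat \<Rightarrow> nat set"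
  assumes inj_L: "inj_on L {1..n}" and inj_R: "inj_on R {1..n}"
    and C_0: "C 0 = {}"
    and C_Suc: "C (Suc j) =
      (if (if P (Suc j) then R (Suc j) else L (Suc j)) \<notin> C j
       then insert (if P (Suc j) then R (Suc j) else L (Suc j)) (C j)
       else if (if P (Suc j) then L (Suc j) else R (Suc j)) \<notin> C j
       then insert (if P (Suc j) then L (Suc j) else R (Suc j)) (C j)
       else C j)"
begin

definition left_takers :: "nat set" where
  "left_takers = {j. L j \<notin> C (j - 1) \<and> (P j \<longrightarrow> R j \<in> C (j - 1))}"

definition right_takers :: "nat set" where
  "right_takers = {j. R j \<notin> C (j - 1) \<and> (\<not> P j \<longrightarrow> L j \<in> C (j - 1))}"

definition empty_handed :: "nat set" where
  "empty_handed = {j. L j \<in> C (j - 1) \<and> R j \<in> C (j - 1)}"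

lemma claimed_by_taker:
  "x \<in> C j \<Longrightarrow> \<exists>k\<in>{1..j}. k \<in> left_takers \<and> L k = x \<or> k \<in> right_takers \<and> R k = x"
proof (induction j)
  case 0
  then show ?case by (simp add: C_0)
next
  case (Suc j)
  show ?case
  proof (cases "x \<in> C j")
    case True
    with Suc.IH show ?thesis by fastforce
  next
    case False
    then have "Suc j \<in> left_takers \<and> L (Suc j) = x \<or> Suc j \<in> right_takers \<and> R (Suc j) = x"
      using Suc.prems unfolding left_takers_def right_takers_def
      by (auto simp: C_Suc split: if_splits)
    then show ?thesis by force
  qed
qed

text \<open>Injectivity of \<open>R\<close> means that nobody else has \<open>R i\<close> as a right
  napkin, so whoever claimed it before \<open>i\<close> sat down took it as a left napkin.\<close>

lemma claimed_right_napkin: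
  assumes "i \<in> {1..n}" "R i \<in> C (i - 1)"
  shows "\<exists>k\<in>{1..i - 1}. k \<in> left_takers \<and> L k = R i"
proof -
  obtain k where k: "k \<in> {1..i - 1}"
    "k \<in> left_takers \<and> L k = R i \<or> k \<in> right_takers \<and> R k = R i"
    using claimed_by_taker[OF assms(2)] by blast
  have "k \<in> {1..n}" "k \<noteq> i" using k(1) assms(1) by auto
  then have "R k \<noteq> R i" using inj_onD[OF inj_R, of k i] assms(1) by blast
  with k show ?thesis by blast
qed

text \<open>Each diner who finds the right napkin gone is charged to the left taker holding it.
  Distinct diners have distinct right napkins, so no holder is charged twice.\<close>

lemma card_displaced_le:
  assumes "t \<le> n"
  shows "card {i\<in>{1..t}. R i \<in> C (i - 1)} \<le> card ({1..t} \<inter> left_takers)"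
proof -
  have "inj_on R {i\<in>{1..t}. R i \<in> C (i - 1)}"
    by (rule inj_on_subset[OF inj_R]) (use assms in auto)
  then have "card {i\<in>{1..t}. R i \<in> C (i - 1)} = card (R ` {i\<in>{1..t}. R i \<in> C (i - 1)})"
    by (simp add: card_image)
  also have "R ` {i\<in>{1..t}. R i \<in> C (i - 1)} \<subseteq> L ` ({1..t} \<inter> left_takers)"
  proof (rule image_subsetI)
    fix i assume i: "i \<in> {i\<in>{1..t}. R i \<in> C (i - 1)}"
    obtain k where "k \<in> {1..i - 1}" "k \<in> left_takers" "L k = R i"
      using claimed_right_napkin[of i] i assms by auto
    with i show "R i \<in> L ` ({1..t} \<inter> left_takers)"
      by (intro image_eqI[of _ _ k]) auto
  qed
  then have "card (R ` {i\<in>{1..t}. R i \<in> C (i - 1)}) \<le> card (L ` ({1..t} \<inter> left_takers))"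
    by (intro card_mono) auto
  also have "\<dots> \<le> card ({1..t} \<inter> left_takers)"
    by (rule card_image_le) auto
  finally show ?thesis .
qed

text \<open>Those who find the right napkin gone include the empty-handed diners and, disjointly,
  the left takers who wanted right. Together they are at most as many as all left takers; cancelling
  the left takers who wanted right leaves this bound.\<close>

lemma card_empty_handed_le:
  assumes "t \<le> n"
  shows "card ({1..t} \<inter> empty_handed) \<le> card ({1..t} \<inter> left_takers \<inter> {i. \<not> P i})"
proof -
  have "card ({1..t} \<inter> empty_handed) + card ({1..t} \<inter> left_takers \<inter> {i. P i}) =
      card (({1..t} \<inter> empty_handed) \<union> ({1..t} \<inter> left_takers \<inter> {i. P i}))"
    by (rule card_Un_disjoint[symmetric]) (auto simp: empty_handed_def left_takers_def)
  also have "\<dots> \<le> card {i\<in>{1..t}. R i \<in> C (i - 1)}"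
    by (intro card_mono) (auto simp: empty_handed_def left_takers_def)
  also have "\<dots> \<le> card ({1..t} \<inter> left_takers)"
    by (rule card_displaced_le[OF assms])
  also have "\<dots> = card (({1..t} \<inter> left_takers \<inter> {i. P i}) \<union> ({1..t} \<inter> left_takers \<inter> {i. \<not> P i}))"
    by (rule arg_cong[where f = card]) auto
  also have "\<dots> = card ({1..t} \<inter> left_takers \<inter> {i. P i}) +
      card ({1..t} \<inter> left_takers \<inter> {i. \<not> P i})"
    by (rule card_Un_disjoint) auto
  finally show ?thesis by simp
qed

text \<open>The preceding bound is used at both times \<open>n\<close> and \<open>t\<close>. Before
  \<open>t\<close>, left takers who prefer left are bounded by all diners who prefer left; after
  \<open>t\<close>, they share the remaining \<open>n - t\<close> places with the
  empty-handed.\<close>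

lemma two_card_empty_handed_le:
  assumes t: "t \<le> n"
  shows "2 * card ({1..n} \<inter> empty_handed) + card {i\<in>{1..t}. P i} \<le>
    n + card {i\<in>{1..t}. \<not> P i}"
proof -
  define late where "late = {Suc t..n} \<inter> left_takers \<inter> {i. \<not> P i}"
  have split: "card ({1..n} \<inter> B) = card ({1..t} \<inter> B) + card ({Suc t..n} \<inter> B)" for B
  proof -
    have "{1..n} \<inter> B = ({1..t} \<inter> B) \<union> ({Suc t..n} \<inter> B)" using t by auto
    moreover have "card (({1..t} \<inter> B) \<union> ({Suc t..n} \<inter> B)) = card ({1..t} \<inter> B) + card ({Suc t..n} \<inter> B)"
      by (rule card_Un_disjoint) auto
    ultimately show ?thesis by simp
  qed
  have early: "card ({1..t} \<inter> left_takers \<inter> {i. \<not> P i}) \<le> card {i\<in>{1..t}. \<not> P i}"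
    by (intro card_mono) auto
  have 1: "card ({1..n} \<inter> empty_handed) \<le> card {i\<in>{1..t}. \<not> P i} + card late"
    using card_empty_handed_le[of n] split[of "left_takers \<inter> {i. \<not> P i}"] early
    by (simp add: late_def Int_assoc)
  have 2: "card ({1..t} \<inter> empty_handed) \<le> card {i\<in>{1..t}. \<not> P i}"
    using card_empty_handed_le[OF t] early by simp
  have "card ({Suc t..n} \<inter> empty_handed) + card late = card (({Suc t..n} \<inter> empty_handed) \<union> late)"
    by (rule card_Un_disjoint[symmetric]) (auto simp: late_def empty_handed_def left_takers_def)
  also have "\<dots> \<le> card {Suc t..n}"
    by (intro card_mono) (auto simp: late_def)
  finally have 3: "card ({Suc t..n} \<inter> empty_handed) + card late \<le> n - t" by simp
  have "card {i\<in>{1..t}. P i} + card {i\<in>{1..t}. \<not> P i} = card ({i\<in>{1..t}. P i} \<union> {i\<in>{1..t}. \<not> P i})"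
    by (rule card_Un_disjoint[symmetric]) auto
  also have "{i\<in>{1..t}. P i} \<union> {i\<in>{1..t}. \<not> P i} = {1..t}" by auto
  finally have 4: "card {i\<in>{1..t}. P i} + card {i\<in>{1..t}. \<not> P i} = t" by simp
  \<comment> \<open>Adding \<open>1\<close>, \<open>2\<close> and \<open>3\<close> cancels
    \<open>late\<close> and counts every empty-handed diner twice; \<open>4\<close> then eliminates
    \<open>t\<close>.\<close>
  show ?thesis using 1 2 3 4 split[of empty_handed] t by linarith
qed

lemma card_empty_handed_le_left_takers:
  "card ({1..n} \<inter> empty_handed) \<le> card ({1..n} \<inter> left_takers)"
  using card_empty_handed_le[of n] card_mono[of "{1..n} \<inter> left_takers" "{1..n} \<inter> left_takers \<inter> {i. \<not> P i}"]
  by (meson Int_lower1 finite_Int finite_atLeastAtMost le_trans order_refl)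

lemma mirror: "claim_process n R L (\<lambda>j. \<not> P j) C"
  by unfold_locales (use inj_L inj_R in \<open>auto simp: C_0 C_Suc\<close>)

lemma mirror_empty_handed: "claim_process.empty_handed R L C = empty_handed"
  unfolding claim_process.empty_handed_def[OF mirror] empty_handed_def by auto

lemma mirror_left_takers: "claim_process.left_takers R L (\<lambda>j. \<not> P j) C = right_takers"
  unfolding claim_process.left_takers_def[OF mirror] right_takers_def by auto

text \<open>Left takers, right takers and empty-handed diners are disjoint, and by the mirror
  symmetry each of the first two classes is at least as large as the third.\<close>

lemma three_card_empty_handed_le: "3 * card ({1..n} \<inter> empty_handed) \<le> n"
proof -
  have "card ({1..n} \<inter> empty_handed) \<le> card ({1..n} \<inter> right_takers)"
    using claim_process.card_empty_handed_le_left_takers[OF mirror]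
    by (simp add: mirror_empty_handed mirror_left_takers)
  moreover have "card ({1..n} \<inter> left_takers) + card ({1..n} \<inter> right_takers) +
      card ({1..n} \<inter> empty_handed) =
      card (({1..n} \<inter> left_takers) \<union> ({1..n} \<inter> right_takers) \<union> ({1..n} \<inter> empty_handed))"
  proof -
    have "({1..n} \<inter> left_takers) \<inter> ({1..n} \<inter> right_takers) = {}"
      "(({1..n} \<inter> left_takers) \<union> ({1..n} \<inter> right_takers)) \<inter> ({1..n} \<inter> empty_handed) = {}"
      by (auto simp: left_takers_def right_takers_def empty_handed_def)
    then show ?thesis by (simp add: card_Un_disjoint)
  qed
  moreover have "\<dots> \<le> card {1..n}"
    by (intro card_mono) auto
  ultimately show ?thesis using card_empty_handed_le_left_takers by simp
qed

lemma two_card_empty_handed_le':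
  assumes "t \<le> n"
  shows "2 * card ({1..n} \<inter> empty_handed) + card {i\<in>{1..t}. \<not> P i} \<le>
    n + card {i\<in>{1..t}. P i}"
  using claim_process.two_card_empty_handed_le[OF mirror assms]
  by (simp add: mirror_empty_handed)

end

section \<open>Seating orders as claiming processes\<close>

lemma inv_seating_bij:
  assumes "w \<in> seating_orders n"
  shows "inj (inv w)" and "j \<in> {1..n} \<Longrightarrow> inv w j \<in> {1..n}"
proof -
  have w: "inv w permutes {1..n}"
    using assms by (auto simp: seating_orders_def intro: permutes_inv)
  show "inj (inv w)" by (rule permutes_inj[OF w])
  show "inv w j \<in> {1..n}" if "j \<in> {1..n}" using that permutes_in_image[OF w] by blast
qed

lemma claim_process_seating:
  assumes "w \<in> seating_orders n"
  shows "claim_process n (\<lambda>j. left_napkin n (inv w j)) (\<lambda>j. right_napkin (inv w j))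
    (\<lambda>j. \<sigma> j = 1) (claimed n w \<sigma>)"
proof
  show "inj_on (\<lambda>j. left_napkin n (inv w j)) {1..n}"
  proof (rule inj_onI)
    fix x y assume xy: "x \<in> {1..n}" "y \<in> {1..n}"
      and eq: "left_napkin n (inv w x) = left_napkin n (inv w y)"
    have "inv w x \<in> {1..n}" "inv w y \<in> {1..n}"
      using inv_seating_bij(2)[OF assms] xy by auto
    with eq have "inv w x = inv w y"
      by (auto simp: left_napkin_def split: if_splits)
    then show "x = y" using inv_seating_bij(1)[OF assms] by (simp add: inj_eq)
  qed
  show "inj_on (\<lambda>j. right_napkin (inv w j)) {1..n}"
    using inv_seating_bij(1)[OF assms] by (auto simp: right_napkin_def inj_def inj_on_def)
qed (auto simp: Let_def preferred_napkin_def other_napkin_def)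

lemma napkinless_upper_bounds:
  assumes w: "w \<in> seating_orders n" and \<sigma>: "\<sigma> \<in> preference_orders n"
  shows "3 * \<nu> n w \<sigma> \<le> n"
    and "t \<le> n \<Longrightarrow> 2 * int (\<nu> n w \<sigma>) + \<bar>\<Sum>i=1..t. \<sigma> i\<bar> \<le> int n"
proof -
  interpret claim_process n "\<lambda>j. left_napkin n (inv w j)" "\<lambda>j. right_napkin (inv w j)"
    "\<lambda>j. \<sigma> j = 1" "claimed n w \<sigma>"
    by (rule claim_process_seating[OF w])
  have \<nu>: "\<nu> n w \<sigma> = card ({1..n} \<inter> empty_handed)"
    unfolding \<nu>_def empty_handed_def napkinless_def preferred_napkin_def other_napkin_def
    by (intro arg_cong[where f = card]) auto
  show "3 * \<nu> n w \<sigma> \<le> n"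
    unfolding \<nu> by (rule three_card_empty_handed_le)
  show "2 * int (\<nu> n w \<sigma>) + \<bar>\<Sum>i=1..t. \<sigma> i\<bar> \<le> int n" if "t \<le> n"
    \<comment> \<open>The bound and its mirror image control the two signs of the partial
      sum.\<close>
    using two_card_empty_handed_le[OF that] two_card_empty_handed_le'[OF that]
      sum_preferences[OF \<sigma> that] unfolding \<nu> by linarith
qed

section \<open>The clairvoyant strategy sets enough traps\<close>

text \<open>While a seat is free, even the last fallback takes its minimum over a nonempty set, so
  the chosen seat belongs to the set named by its branch. The two branches that fill a primed seat
  are merged.\<close>

lemma next_seat_cases:
  assumes "x \<in> {1..n}" "x \<notin> A"
  shows "(s = 1 \<and> free_leftmost n A \<noteq> {} \<and> next_seat n A s \<in> free_leftmost n A) \<or>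
    (s \<noteq> 1 \<and> free_rightmost n A \<noteq> {} \<and> next_seat n A s \<in> free_rightmost n A) \<or>
    (next_seat n A s \<in> primed_seats n A \<and>
      (s = 1 \<longrightarrow> free_leftmost n A = {}) \<and> (s \<noteq> 1 \<longrightarrow> free_rightmost n A = {})) \<or>
    (s = 1 \<and> free_leftmost n A = {} \<and> primed_seats n A = {} \<and> next_seat n A s \<in> free_rightmost n A) \<or>
    (s \<noteq> 1 \<and> free_rightmost n A = {} \<and> primed_seats n A = {} \<and> next_seat n A s \<in> free_leftmost n A)"
proof -
  have fin: "finite (free_leftmost n A)" "finite (primed_seats n A)" "finite (free_rightmost n A)"
    by (rule finite_subset[OF _ finite_atLeastAtMost],
        rule free_leftmost_subset primed_seats_subset free_rightmost_subset)+
  show ?thesis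
    using some_seat_free[OF assms] fin[THEN Min_in] unfolding next_seat_def by auto
qed

locale trap_setting =
  fixes n :: nat and \<sigma> :: "nat \<Rightarrow> int"
  assumes \<sigma>: "\<sigma> \<in> preference_orders n"
begin

abbreviation "seat \<equiv> trap_seat n \<sigma>"
abbreviation "A \<equiv> assigned_seats n \<sigma>"
abbreviation "q \<equiv> n div 3"
abbreviation "leftmost \<equiv> (\<lambda>j. 3 * j - 2) ` {1..q}"
abbreviation "rightmost \<equiv> (\<lambda>j. 3 * j) ` {1..q}"

lemma free_leftmost_eq: "free_leftmost n B = leftmost - B"
  by (auto simp: free_leftmost_def)

lemma free_rightmost_eq: "free_rightmost n B = rightmost - B"
  by (auto simp: free_rightmost_def)

lemma seat_in_A: "1 \<le> k \<Longrightarrow> k \<le> i \<Longrightarrow> seat k \<in> A i"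
  by (simp add: assigned_seats_eq)

lemma A_mono: "i \<le> k \<Longrightarrow> A i \<subseteq> A k"
  unfolding assigned_seats_eq by (intro image_mono) auto

lemma free_seat_exists:
  assumes "k \<in> {1..n}"
  shows "\<exists>x\<in>{1..n}. x \<notin> A (k - 1)"
proof (rule ccontr)
  assume "\<not> ?thesis"
  then have "{1..n} \<subseteq> A (k - 1)" by blast
  then have "card {1..n} \<le> card (A (k - 1))"
    by (intro card_mono) (auto simp: assigned_seats_eq)
  then show False using assigned_seats_card[of "k - 1" n \<sigma>] assms by auto
qed

lemma seat_cases:
  assumes "k \<in> {1..n}"
  shows "(\<sigma> k = 1 \<and> \<not> leftmost \<subseteq> A (k - 1) \<and> seat k \<in> leftmost - A (k - 1)) \<or>
    (\<sigma> k \<noteq> 1 \<and> \<not> rightmost \<subseteq> A (k - 1) \<and> seat k \<in> rightmost - A (k - 1)) \<or>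
    (seat k \<in> primed_seats n (A (k - 1)) \<and>
      (\<sigma> k = 1 \<longrightarrow> leftmost \<subseteq> A (k - 1)) \<and> (\<sigma> k \<noteq> 1 \<longrightarrow> rightmost \<subseteq> A (k - 1))) \<or>
    (\<sigma> k = 1 \<and> leftmost \<subseteq> A (k - 1) \<and> primed_seats n (A (k - 1)) = {} \<and> seat k \<in> rightmost - A (k - 1)) \<or>
    (\<sigma> k \<noteq> 1 \<and> rightmost \<subseteq> A (k - 1) \<and> primed_seats n (A (k - 1)) = {} \<and> seat k \<in> leftmost - A (k - 1))"
proof -
  obtain x where "x \<in> {1..n}" "x \<notin> A (k - 1)" using free_seat_exists[OF assms] by blast
  from next_seat_cases[OF this, of "\<sigma> k"] show ?thesis
    unfolding free_leftmost_eq free_rightmost_eq trap_seat_def Diff_eq_empty_iff .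
qed

text \<open>Residues modulo 3 tell the three seats of a bench apart. Writing
  \<open>j = Suc i\<close> removes the truncated subtraction.\<close>

lemma seat_mod:
  "x \<in> leftmost \<Longrightarrow> x mod 3 = 1 \<and> x \<le> 3 * q" "x \<in> rightmost \<Longrightarrow> x mod 3 = 0 \<and> x \<le> 3 * q"
  and centre_mod: "j \<in> {1..q} \<Longrightarrow> (3 * j - 1) mod 3 = 2"
proof -
  show "x mod 3 = 1 \<and> x \<le> 3 * q" if x: "x \<in> leftmost"
  proof -
    obtain j where "1 \<le> j" "j \<le> q" "x = 3 * j - 2" using x by auto
    moreover from this obtain i where "j = Suc i" by (cases j) auto
    ultimately have "x = 1 + 3 * i" "x \<le> 3 * q" by auto
    then show ?thesis by simp
  qed
  show "x mod 3 = 0 \<and> x \<le> 3 * q" if "x \<in> rightmost"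
    using that by auto
  show "(3 * j - 1) mod 3 = 2" if j: "j \<in> {1..q}"
  proof -
    obtain i where "j = Suc i" using j by (cases j) auto
    then have "(3 * j - 1) mod 3 = (2 + 3 * i) mod 3" by simp
    also have "\<dots> = 2 mod 3" by (rule mod_mult_self2)
    finally show ?thesis by simp
  qed
qed

lemma seat_kinds:
  "j \<in> {1..q} \<Longrightarrow> 3 * j - 1 \<notin> leftmost" "j \<in> {1..q} \<Longrightarrow> 3 * j - 1 \<notin> rightmost"
  "x \<in> primed_seats n B \<Longrightarrow> x \<notin> leftmost" "x \<in> primed_seats n B \<Longrightarrow> x \<notin> rightmost"
  "leftmost \<inter> rightmost = {}"
proof -
  show c: "3 * j - 1 \<notin> leftmost" "3 * j - 1 \<notin> rightmost" if "j \<in> {1..q}" for j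
    using seat_mod(1)[of "3 * j - 1"] seat_mod(2)[of "3 * j - 1"] centre_mod[OF that] by linarith+
  have "x > 3 * q \<or> (\<exists>j\<in>{1..q}. x = 3 * j - 1)" if "x \<in> primed_seats n B"
    using that unfolding primed_seats_def by fastforce
  then show "x \<notin> leftmost" "x \<notin> rightmost" if "x \<in> primed_seats n B"
    using that seat_mod(1,2)[of x] c by (metis linorder_not_less)+
  show "leftmost \<inter> rightmost = {}"
    using seat_mod(1,2) by (metis disjoint_iff zero_neq_one)
qed

lemma primed_centre:
  assumes "j \<in> {1..q}" "3 * j - 1 \<in> primed_seats n B"
  shows "3 * j - 2 \<in> B" "3 * j \<in> B"
proof -
  have "3 * j - 1 \<notin> {3 * q + 1..n}" using assms(1) by auto
  then obtain j' where j': "3 * j - 1 = 3 * j' - 1" "j' \<in> {1..q}" "3 * j' - 2 \<in> B" "3 * j' \<in> B"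
    using assms(2) unfolding primed_seats_def by auto
  then have "j' = j" using assms(1) by auto
  with j' show "3 * j - 2 \<in> B" "3 * j \<in> B" by auto
qed

text \<open>Every branch other than the primed one chooses an end seat of a bench, so a centre seat
  can only be filled once both of its neighbours are.\<close>

lemma centre_seated_when_primed:
  assumes "k \<in> {1..n}" "j \<in> {1..q}" "seat k = 3 * j - 1"
  shows "3 * j - 2 \<in> A (k - 1)" "3 * j \<in> A (k - 1)"
proof -
  have "seat k \<in> primed_seats n (A (k - 1))"
    using seat_cases[OF assms(1)] seat_kinds(1,2)[OF assms(2)] assms(3) by auto
  then show "3 * j - 2 \<in> A (k - 1)" "3 * j \<in> A (k - 1)"
    using primed_centre[OF assms(2)] assms(3) by auto
qed

lemma centre_assigned:
  assumes "i \<le> n" "j \<in> {1..q}" "3 * j - 1 \<in> A i"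
  shows "3 * j - 2 \<in> A i" "3 * j \<in> A i"
proof -
  obtain k where k: "k \<in> {1..i}" "seat k = 3 * j - 1"
    using assms(3) by (auto simp: assigned_seats_eq)
  then have "k \<in> {1..n}" using assms(1) by auto
  moreover have "A (k - 1) \<subseteq> A i" using k(1) by (intro A_mono) auto
  ultimately show "3 * j - 2 \<in> A i" "3 * j \<in> A i"
    using centre_seated_when_primed[of k j] k(2) assms(2) by auto
qed

section \<open>Occupied seats when no bench is primed\<close>

lemma card_A:
  assumes "i \<le> n"
  shows "i = card (A i \<inter> leftmost) + card (A i \<inter> rightmost) +
    card {j\<in>{1..q}. 3 * j - 1 \<in> A i} + card (A i \<inter> {3 * q + 1..n})"
proof -
  define M where "M = (\<lambda>j. 3 * j - 1) ` {j\<in>{1..q}. 3 * j - 1 \<in> A i}"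
  have A: "A i \<subseteq> {1..n}" "card (A i) = i"
    using assigned_seats_card[OF assms] by auto
  have fin: "finite (A i)" by (simp add: assigned_seats_eq)
  have M: "card M = card {j\<in>{1..q}. 3 * j - 1 \<in> A i}" "finite M"
    unfolding M_def by (auto intro!: card_image inj_onI)
  have "A i = (A i \<inter> leftmost) \<union> (A i \<inter> rightmost) \<union> M \<union> (A i \<inter> {3 * q + 1..n})"
  proof
    show "A i \<subseteq> (A i \<inter> leftmost) \<union> (A i \<inter> rightmost) \<union> M \<union> (A i \<inter> {3 * q + 1..n})"
    proof
      fix x assume x: "x \<in> A i"
      define j where "j = (x + 2) div 3"
      have xn: "x \<in> {1..n}" using x A by blast
      show "x \<in> (A i \<inter> leftmost) \<union> (A i \<inter> rightmost) \<union> M \<union> (A i \<inter> {3 * q + 1..n})"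
      proof (cases "x \<le> 3 * q")
        case True
        then have j: "j \<in> {1..q}" using xn by (auto simp: j_def)
        have "x = 3 * j - 2 \<or> x = 3 * j - 1 \<or> x = 3 * j"
          using xn unfolding j_def by auto
        with j x show ?thesis unfolding M_def by blast
      qed (use x xn in auto)
    qed
  qed (auto simp: M_def)
  then have "card (A i) = card ((A i \<inter> leftmost) \<union> (A i \<inter> rightmost) \<union> M \<union> (A i \<inter> {3 * q + 1..n}))"
    by (rule arg_cong)
  also have "\<dots> = card (A i \<inter> leftmost) + card (A i \<inter> rightmost) + card M + card (A i \<inter> {3 * q + 1..n})"
  proof -
    have "(A i \<inter> leftmost) \<inter> (A i \<inter> rightmost) = {}"
      using seat_kinds(5) by auto
    moreover have "x \<notin> leftmost" "x \<notin> rightmost" if xM: "x \<in> M" for x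
    proof -
      obtain j where "j \<in> {1..q}" "x = 3 * j - 1" using xM unfolding M_def by blast
      then show "x \<notin> leftmost" "x \<notin> rightmost" using seat_kinds(1,2) by metis+
    qed
    then have "((A i \<inter> leftmost) \<union> (A i \<inter> rightmost)) \<inter> M = {}"
      by blast
    moreover have "((A i \<inter> leftmost) \<union> (A i \<inter> rightmost) \<union> M) \<inter> (A i \<inter> {3 * q + 1..n}) = {}"
      by (auto simp: M_def)
    ultimately show ?thesis using fin M(2) by (simp add: card_Un_disjoint)
  qed
  finally show ?thesis using A(2) M(1) by simp
qed

text \<open>Without a primed bench all \<open>n - 3 * q\<close> remainder seats are taken, and a
  centre is taken exactly when both ends of its bench are. If one side is full, the taken centres
  therefore match the \<open>a\<close> taken seats of the other side, so
  \<open>i = 2 * a + q + (n - 3 * q)\<close>.\<close>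

lemma card_A_no_primed:
  assumes "i \<le> n" "primed_seats n (A i) = {}"
  shows "rightmost \<subseteq> A i \<Longrightarrow> i + 2 * q = 2 * card (A i \<inter> leftmost) + n"
    and "leftmost \<subseteq> A i \<Longrightarrow> i + 2 * q = 2 * card (A i \<inter> rightmost) + n"
proof -
  have centres: "{j\<in>{1..q}. 3 * j - 1 \<in> A i} = {j\<in>{1..q}. 3 * j - 2 \<in> A i \<and> 3 * j \<in> A i}"
    using assms(2) centre_assigned[OF assms(1)] unfolding primed_seats_def by blast
  have "{3 * q + 1..n} \<subseteq> A i"
    using assms(2) unfolding primed_seats_def by blast
  then have rem: "card (A i \<inter> {3 * q + 1..n}) = n - 3 * q"
    by (simp add: Int_absorb1)
  have cl: "card leftmost = q" and cr: "card rightmost = q"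
    by (subst card_image; auto intro!: inj_onI)+
  {
    assume r: "rightmost \<subseteq> A i"
    then have "A i \<inter> leftmost = (\<lambda>j. 3 * j - 2) ` {j\<in>{1..q}. 3 * j - 1 \<in> A i}"
      unfolding centres by auto
    moreover have "inj_on (\<lambda>j::nat. 3 * j - 2) {j\<in>{1..q}. 3 * j - 1 \<in> A i}"
      by (auto intro!: inj_onI)
    ultimately have "card (A i \<inter> leftmost) = card {j\<in>{1..q}. 3 * j - 1 \<in> A i}"
      by (simp only: card_image)
    moreover have "card (A i \<inter> rightmost) = q" using r cr by (simp add: Int_absorb1)
    moreover have "3 * q \<le> n" by simp
    ultimately show "i + 2 * q = 2 * card (A i \<inter> leftmost) + n"
      using card_A[OF assms(1)] rem by linarith
  next
    assume l: "leftmost \<subseteq> A i"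
    then have "A i \<inter> rightmost = (\<lambda>j. 3 * j) ` {j\<in>{1..q}. 3 * j - 1 \<in> A i}"
      unfolding centres by auto
    moreover have "inj_on (\<lambda>j::nat. 3 * j) {j\<in>{1..q}. 3 * j - 1 \<in> A i}"
      by (auto intro!: inj_onI)
    ultimately have "card (A i \<inter> rightmost) = card {j\<in>{1..q}. 3 * j - 1 \<in> A i}"
      by (simp only: card_image)
    moreover have "card (A i \<inter> leftmost) = q" using l cl by (simp add: Int_absorb1)
    moreover have "3 * q \<le> n" by simp
    ultimately show "i + 2 * q = 2 * card (A i \<inter> rightmost) + n"
      using card_A[OF assms(1)] rem by linarith
  }
qed

text \<open>Symmetric in left and right: \<open>F\<close> is one side of the benches and \<open>T\<close> holds for the diners who,
  seated there, prefer the napkin next to the centre seat.  At the last spoilt seat of \<open>F\<close> there is no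
  primed bench and all seats of the other side are taken, which determines the preferences so far.\<close>

lemma last_spoiler:
  fixes T :: "nat \<Rightarrow> bool" and F :: "nat set"
  assumes T: "\<And>k. k \<in> {1..n} \<Longrightarrow> T k \<Longrightarrow> \<not> F \<subseteq> A (k - 1) \<Longrightarrow> seat k \<in> F"
    and spoil: "\<And>k. k \<in> {1..n} \<Longrightarrow> \<not> T k \<Longrightarrow> seat k \<in> F \<Longrightarrow>
      seat k \<notin> A (k - 1) \<and> k - 1 + 2 * q = 2 * card (A (k - 1) \<inter> F) + n"
    and ne: "{k\<in>{1..n}. \<not> T k \<and> seat k \<in> F} \<noteq> {}"
  shows "\<exists>k\<in>{1..n}. card {i\<in>{1..k}. \<not> T i} + 2 * q + 1 =
    card {i\<in>{1..k}. T i} + n + 2 * card {k\<in>{1..n}. \<not> T k \<and> seat k \<in> F}"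
proof -
  define X where "X = {k\<in>{1..n}. \<not> T k \<and> seat k \<in> F}"
  define k where "k = Max X"
  have fin: "finite X" unfolding X_def by auto
  have "k \<in> X" unfolding k_def using ne by (intro Max_in[OF fin]) (simp add: X_def)
  then have k: "k \<in> {1..n}" "\<not> T k" "seat k \<in> F" by (auto simp: X_def)
  have X_le: "X \<subseteq> {1..k}"
    using Max_ge[OF fin] by (auto simp: X_def k_def)
  \<comment> \<open>The seat of \<open>k\<close> lies in \<open>F\<close> and is still free just
    before \<open>k\<close>, hence at all earlier times too.\<close>
  have nF: "\<not> F \<subseteq> A (i - 1)" if "i \<in> {1..k}" for i
  proof -
    have "A (i - 1) \<subseteq> A (k - 1)" using that by (intro A_mono) auto
    then show ?thesis using spoil[OF k] k(3) by blast
  qed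
  \<comment> \<open>As \<open>F\<close> has not been full so far, every diner satisfying
    \<open>T\<close> went to \<open>F\<close>; the only other occupants of \<open>F\<close> are the
    earlier spoilers.\<close>
  have F_eq: "A (k - 1) \<inter> F = seat ` ({i\<in>{1..k - 1}. T i} \<union> (X - {k}))"
  proof
    show "A (k - 1) \<inter> F \<subseteq> seat ` ({i\<in>{1..k - 1}. T i} \<union> (X - {k}))"
    proof
      fix x assume "x \<in> A (k - 1) \<inter> F"
      then obtain i where "i \<in> {1..k - 1}" "x = seat i" "seat i \<in> F"
        by (auto simp: assigned_seats_eq)
      then show "x \<in> seat ` ({i\<in>{1..k - 1}. T i} \<union> (X - {k}))"
        using k(1) by (cases "T i") (auto simp: X_def)
    qed
    show "seat ` ({i\<in>{1..k - 1}. T i} \<union> (X - {k})) \<subseteq> A (k - 1) \<inter> F"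
    proof (rule image_subsetI)
      fix i assume i: "i \<in> {i\<in>{1..k - 1}. T i} \<union> (X - {k})"
      then have ik: "1 \<le> i" "i \<le> k - 1"
        using X_le by (auto simp: X_def)
      moreover have "seat i \<in> F"
      proof (cases "T i")
        case True
        then show ?thesis using T[of i] nF[of i] ik k(1) by auto
      next
        case False
        with i show ?thesis by (auto simp: X_def)
      qed
      ultimately show "seat i \<in> A (k - 1) \<inter> F" using seat_in_A by blast
    qed
  qed
  have "inj_on seat {1..n}"
    using bij_betw_trap_seat[of n \<sigma>] by (simp add: bij_betw_def)
  then have "inj_on seat ({i\<in>{1..k - 1}. T i} \<union> (X - {k}))"
    by (rule inj_on_subset) (use k(1) in \<open>auto simp: X_def\<close>)
  then have "card (A (k - 1) \<inter> F) = card ({i\<in>{1..k - 1}. T i} \<union> (X - {k}))"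
    unfolding F_eq by (rule card_image)
  also have "\<dots> = card {i\<in>{1..k - 1}. T i} + card (X - {k})"
    using fin by (intro card_Un_disjoint) (auto simp: X_def)
  also have "{i\<in>{1..k - 1}. T i} = {i\<in>{1..k}. T i}"
    using k(2) by (auto simp: le_eq_less_or_eq)
  finally have 1: "card (A (k - 1) \<inter> F) = card {i\<in>{1..k}. T i} + card (X - {k})" .
  have 2: "card X = card (X - {k}) + 1"
    using \<open>k \<in> X\<close> fin by (metis Suc_eq_plus1 card_Suc_Diff1)
  have "card {i\<in>{1..k}. T i} + card {i\<in>{1..k}. \<not> T i} = card ({i\<in>{1..k}. T i} \<union> {i\<in>{1..k}. \<not> T i})"
    by (rule card_Un_disjoint[symmetric]) auto
  also have "{i\<in>{1..k}. T i} \<union> {i\<in>{1..k}. \<not> T i} = {1..k}" by auto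
  finally have 3: "card {i\<in>{1..k}. T i} + card {i\<in>{1..k}. \<not> T i} = k" by simp
  \<comment> \<open>The seat count in \<open>spoil\<close> refers to the moment before
    \<open>k\<close>, when one element of \<open>X\<close> is still missing; this is the source of
    the \<open>+ 1\<close>.\<close>
  have "card {i\<in>{1..k}. \<not> T i} + 2 * q + 1 = card {i\<in>{1..k}. T i} + n + 2 * card X"
    using 1 2 3 spoil[OF k] k(1) by auto
  with k(1) show ?thesis unfolding X_def by blast
qed

section \<open>Diners who spoil a bench\<close>

text \<open>Such a diner prefers the napkin away from the centre seat, so the bench is no longer
  sure to trap its centre.\<close>

definition spoilt_left :: "nat set" where
  "spoilt_left = {k\<in>{1..n}. \<sigma> k \<noteq> 1 \<and> seat k \<in> leftmost}"

text \<open>The double negation matches \<open>\<not> T k\<close> in \<open>last_spoiler\<close> for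
  \<open>T k = (\<sigma> k \<noteq> 1)\<close>.\<close>

definition spoilt_right :: "nat set" where
  "spoilt_right = {k\<in>{1..n}. \<not> \<sigma> k \<noteq> 1 \<and> seat k \<in> rightmost}"

text \<open>Only the last fallback sends a diner who prefers left to a leftmost seat.\<close>

lemma spoilt_leftD:
  assumes "k \<in> spoilt_left"
  shows "rightmost \<subseteq> A (k - 1)" "\<not> leftmost \<subseteq> A (k - 1)" "seat k \<notin> A (k - 1)"
    "primed_seats n (A (k - 1)) = {}"
  using assms seat_cases[of k] seat_kinds(3)[of "seat k" "A (k - 1)"] seat_kinds(5)
  unfolding spoilt_left_def by blast+

lemma spoilt_rightD:
  assumes "k \<in> spoilt_right"
  shows "leftmost \<subseteq> A (k - 1)" "\<not> rightmost \<subseteq> A (k - 1)" "seat k \<notin> A (k - 1)"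
    "primed_seats n (A (k - 1)) = {}"
  using assms seat_cases[of k] seat_kinds(4)[of "seat k" "A (k - 1)"] seat_kinds(5)
  unfolding spoilt_right_def by blast+

text \<open>A spoiler on one side needs the other side full and its own side not full. Occupied
  seats only accumulate, so the side found full by the earlier spoiler could not have room for the
  later one.\<close>

lemma spoilt_one_sided: "spoilt_left = {} \<or> spoilt_right = {}"
proof (rule ccontr)
  assume "\<not> ?thesis"
  then obtain k l where kl: "k \<in> spoilt_left" "l \<in> spoilt_right" by blast
  have "A (k - 1) \<subseteq> A (l - 1) \<or> A (l - 1) \<subseteq> A (k - 1)"
    using A_mono nat_le_linear by blast
  then show False
    using spoilt_leftD(1,2)[OF kl(1)] spoilt_rightD(1,2)[OF kl(2)] by blast
qed

lemma spoilt_left_bound: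
  assumes "spoilt_left \<noteq> {}"
  shows "\<exists>k\<in>{1..n}. card {i\<in>{1..k}. \<sigma> i \<noteq> 1} + 2 * q + 1 =
    card {i\<in>{1..k}. \<sigma> i = 1} + n + 2 * card spoilt_left"
  unfolding spoilt_left_def
proof (rule last_spoiler[where T = "\<lambda>k. \<sigma> k = 1"])
  show "seat k \<in> leftmost" if "k \<in> {1..n}" "\<sigma> k = 1" "\<not> leftmost \<subseteq> A (k - 1)" for k
    using seat_cases[OF that(1)] that by blast
  show "seat k \<notin> A (k - 1) \<and> k - 1 + 2 * q = 2 * card (A (k - 1) \<inter> leftmost) + n"
    if "k \<in> {1..n}" "\<sigma> k \<noteq> 1" "seat k \<in> leftmost" for k
  proof -
    have "k \<in> spoilt_left" using that by (simp add: spoilt_left_def)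
    note D = spoilt_leftD[OF this]
    have "k - 1 \<le> n" using that(1) by auto
    from D(3) card_A_no_primed(1)[OF this D(4,1)] show ?thesis by blast
  qed
  show "{k\<in>{1..n}. \<sigma> k \<noteq> 1 \<and> seat k \<in> leftmost} \<noteq> {}"
    using assms by (simp add: spoilt_left_def)
qed

lemma spoilt_right_bound:
  assumes "spoilt_right \<noteq> {}"
  shows "\<exists>k\<in>{1..n}. card {i\<in>{1..k}. \<sigma> i = 1} + 2 * q + 1 =
    card {i\<in>{1..k}. \<sigma> i \<noteq> 1} + n + 2 * card spoilt_right"
proof -
  have "\<exists>k\<in>{1..n}. card {i\<in>{1..k}. \<not> \<sigma> i \<noteq> 1} + 2 * q + 1 =
    card {i\<in>{1..k}. \<sigma> i \<noteq> 1} + n + 2 * card spoilt_right"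
    unfolding spoilt_right_def
  proof (rule last_spoiler[where T = "\<lambda>k. \<sigma> k \<noteq> 1"])
    show "seat k \<in> rightmost" if "k \<in> {1..n}" "\<sigma> k \<noteq> 1" "\<not> rightmost \<subseteq> A (k - 1)" for k
      using seat_cases[OF that(1)] that by blast
    show "seat k \<notin> A (k - 1) \<and> k - 1 + 2 * q = 2 * card (A (k - 1) \<inter> rightmost) + n"
      if "k \<in> {1..n}" "\<not> \<sigma> k \<noteq> 1" "seat k \<in> rightmost" for k
    proof -
      have "k \<in> spoilt_right" using that by (simp add: spoilt_right_def)
      note D = spoilt_rightD[OF this]
      have "k - 1 \<le> n" using that(1) by auto
      from D(3) card_A_no_primed(2)[OF this D(4,1)] show ?thesis by blast
    qed
    show "{k\<in>{1..n}. \<not> \<sigma> k \<noteq> 1 \<and> seat k \<in> rightmost} \<noteq> {}"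
      using assms by (simp add: spoilt_right_def)
  qed
  then show ?thesis by simp
qed

end

section \<open>From filled benches to napkinless diners\<close>

text \<open>A diner takes the preferred napkin unless it is already gone, so it is claimed either
  way, and claims are never released.\<close>

lemma preferred_in_claimed:
  assumes "1 \<le> j" "j \<le> k"
  shows "preferred_napkin n w \<sigma> j \<in> claimed n w \<sigma> k"
  using assms(2)
proof (induction k rule: dec_induct)
  case base
  show ?case using assms(1) by (cases j) (auto simp: Let_def)
next
  case (step k)
  then show ?case by (auto simp: Let_def)
qed

lemma inv_trap_seating:
  assumes "k \<in> {1..n}"
  shows "inv (trap_seating n \<sigma>) k = rotated_trap_seat n \<sigma> k"
proof -
  have n: "n \<ge> 1" using assms by auto
  note b = bij_betw_rotated_trap_seat[OF n, of \<sigma>]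
  have "trap_seating n \<sigma> (rotated_trap_seat n \<sigma> k) = k"
    using b bij_betw_apply[OF b assms] assms
    by (simp add: trap_seating_def bij_betw_def inv_into_f_f)
  moreover have "inj (trap_seating n \<sigma>)"
    using trap_seating_in_seating_orders[OF n, of \<sigma>]
    by (auto simp: seating_orders_def permutes_inj)
  ultimately show ?thesis by (simp add: inv_f_eq)
qed

text \<open>Rotation preserves adjacency. When the rotated seats are \<open>n\<close> and
  \<open>1\<close>, the wrap-around in \<open>left_napkin\<close> supplies napkin
  \<open>n\<close>.\<close>

lemma left_napkin_rotated:
  assumes "k \<in> {1..n}" "l \<in> {1..n}" "trap_seat n \<sigma> l = Suc (trap_seat n \<sigma> k)"
  shows "left_napkin n (rotated_trap_seat n \<sigma> l) = right_napkin (rotated_trap_seat n \<sigma> k)"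
proof -
  have "trap_seat n \<sigma> 1 \<in> {1..n}"
    using assms(1) by (intro bij_betw_apply[OF bij_betw_trap_seat]) auto
  then have "Suc (trap_seat n \<sigma> k) + n - trap_seat n \<sigma> 1 = Suc (trap_seat n \<sigma> k + n - trap_seat n \<sigma> 1)"
    by auto
  then show ?thesis
    by (simp add: left_napkin_def right_napkin_def rotated_trap_seat_def assms(3) mod_Suc)
qed

context trap_setting
begin

text \<open>The end diners both sit before the centre is filled, and their preferred napkins are
  precisely the two napkins of the centre seat.\<close>

lemma trapped_napkinless:
  assumes "l \<in> {1..n}" "c \<in> {1..n}" "r \<in> {1..n}" "j \<in> {1..q}"
    and l: "seat l = 3 * j - 2" "\<sigma> l = 1"
    and c: "seat c = 3 * j - 1"
    and r: "seat r = 3 * j" "\<sigma> r \<noteq> 1"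
  shows "napkinless n (trap_seating n \<sigma>) \<sigma> c"
proof -
  let ?w = "trap_seating n \<sigma>"
  have before: "x \<le> c - 1" if "seat x \<in> A (c - 1)" "x \<in> {1..n}" for x
  proof -
    obtain y where y: "y \<in> {1..c - 1}" "seat y = seat x"
      using \<open>seat x \<in> A (c - 1)\<close> by (auto simp: assigned_seats_eq)
    have "y \<in> {1..n}" using y(1) assms(2) by auto
    then have "y = x"
      using bij_betw_trap_seat[of n \<sigma>] y(2) that(2) by (auto simp: bij_betw_def dest: inj_onD)
    with y(1) show ?thesis by simp
  qed
  have "l \<le> c - 1" "r \<le> c - 1"
    using before[of l] before[of r] centre_seated_when_primed[OF assms(2,4) c] assms(1,3) l(1) r(1)
    by auto
  then have "preferred_napkin n ?w \<sigma> l \<in> claimed n ?w \<sigma> (c - 1)"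
    "preferred_napkin n ?w \<sigma> r \<in> claimed n ?w \<sigma> (c - 1)"
    using assms(1,3) by (auto intro!: preferred_in_claimed)
  moreover have "preferred_napkin n ?w \<sigma> l = left_napkin n (inv ?w c)"
    using left_napkin_rotated[OF assms(1,2), of \<sigma>] l c assms(1,2,4)
    by (auto simp: preferred_napkin_def inv_trap_seating)
  moreover have "preferred_napkin n ?w \<sigma> r = right_napkin (inv ?w c)"
    using left_napkin_rotated[OF assms(2,3), of \<sigma>] r c assms(2,3,4)
    by (auto simp: preferred_napkin_def inv_trap_seating)
  ultimately show ?thesis
    unfolding napkinless_def by (auto simp: preferred_napkin_def other_napkin_def)
qed

text \<open>Each bench either has both end diners preferring the centre side, and then traps its
  centre, or has a spoiler at an end. The map \<open>d\<close> from seats to diners injects each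
  class of benches into the corresponding class of diners.\<close>

lemma benches_le_trapped_plus_spoilt:
  "q \<le> \<nu> n (trap_seating n \<sigma>) \<sigma> + card spoilt_left + card spoilt_right"
proof -
  define d where "d = inv_into {1..n} seat"
  have b: "bij_betw d {1..n} {1..n}"
    unfolding d_def by (rule bij_betw_inv_into[OF bij_betw_trap_seat])
  have seat_d: "seat (d x) = x" if "x \<in> {1..n}" for x
    unfolding d_def by (rule bij_betw_inv_into_right[OF bij_betw_trap_seat that])
  have d_in: "d x \<in> {1..n}" if "x \<in> {1..n}" for x
    by (rule bij_betw_apply[OF b that])
  have d_inj: "x = y" if "d x = d y" "x \<in> {1..n}" "y \<in> {1..n}" for x y
    using seat_d[OF that(2)] seat_d[OF that(3)] that(1) by metis
  have range: "3 * j - 2 \<in> {1..n}" "3 * j - 1 \<in> {1..n}" "3 * j \<in> {1..n}" if "j \<in> {1..q}" for j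
    using that by auto
  define good where "good = {j\<in>{1..q}. \<sigma> (d (3 * j - 2)) = 1 \<and> \<sigma> (d (3 * j)) \<noteq> 1}"
  define bad_left where "bad_left = {j\<in>{1..q}. \<sigma> (d (3 * j - 2)) \<noteq> 1}"
  define bad_right where "bad_right = {j\<in>{1..q}. \<sigma> (d (3 * j)) = 1}"
  have "card good \<le> card {c\<in>{1..n}. napkinless n (trap_seating n \<sigma>) \<sigma> c}"
  proof (rule card_inj_on_le)
    show "inj_on (\<lambda>j. d (3 * j - 1)) good"
    proof (rule inj_onI)
      fix x y assume "x \<in> good" "y \<in> good" and eq: "d (3 * x - 1) = d (3 * y - 1)"
      then have xy: "x \<in> {1..q}" "y \<in> {1..q}" by (auto simp: good_def)
      have "3 * x - 1 = 3 * y - 1"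
        using d_inj[OF eq range(2)[OF xy(1)] range(2)[OF xy(2)]] .
      then show "x = y" using xy by auto
    qed
    show "(\<lambda>j. d (3 * j - 1)) ` good \<subseteq> {c\<in>{1..n}. napkinless n (trap_seating n \<sigma>) \<sigma> c}"
    proof (rule image_subsetI)
      fix j assume "j \<in> good"
      then have j: "j \<in> {1..q}" "\<sigma> (d (3 * j - 2)) = 1" "\<sigma> (d (3 * j)) \<noteq> 1"
        by (auto simp: good_def)
      have "napkinless n (trap_seating n \<sigma>) \<sigma> (d (3 * j - 1))"
        by (rule trapped_napkinless[OF d_in d_in d_in j(1) seat_d j(2) seat_d seat_d j(3)];
            rule range[OF j(1)])
      then show "d (3 * j - 1) \<in> {c\<in>{1..n}. napkinless n (trap_seating n \<sigma>) \<sigma> c}"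
        using d_in range(2)[OF j(1)] by blast
    qed
  qed simp
  moreover have "card bad_left \<le> card spoilt_left"
  proof (rule card_inj_on_le)
    show "inj_on (\<lambda>j. d (3 * j - 2)) bad_left"
    proof (rule inj_onI)
      fix x y assume "x \<in> bad_left" "y \<in> bad_left" and eq: "d (3 * x - 2) = d (3 * y - 2)"
      then have xy: "x \<in> {1..q}" "y \<in> {1..q}" by (auto simp: bad_left_def)
      have "3 * x - 2 = 3 * y - 2"
        using d_inj[OF eq range(1)[OF xy(1)] range(1)[OF xy(2)]] .
      then show "x = y" using xy by auto
    qed
    show "(\<lambda>j. d (3 * j - 2)) ` bad_left \<subseteq> spoilt_left"
    proof (rule image_subsetI)
      fix j assume "j \<in> bad_left"
      then have j: "j \<in> {1..q}" "\<sigma> (d (3 * j - 2)) \<noteq> 1" by (auto simp: bad_left_def)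
      then show "d (3 * j - 2) \<in> spoilt_left"
        unfolding spoilt_left_def using d_in[OF range(1)[OF j(1)]] seat_d[OF range(1)[OF j(1)]]
        by blast
    qed
    show "finite spoilt_left" by (simp add: spoilt_left_def)
  qed
  moreover have "card bad_right \<le> card spoilt_right"
  proof (rule card_inj_on_le)
    show "inj_on (\<lambda>j. d (3 * j)) bad_right"
    proof (rule inj_onI)
      fix x y assume "x \<in> bad_right" "y \<in> bad_right" and eq: "d (3 * x) = d (3 * y)"
      then have xy: "x \<in> {1..q}" "y \<in> {1..q}" by (auto simp: bad_right_def)
      have "3 * x = 3 * y"
        using d_inj[OF eq range(3)[OF xy(1)] range(3)[OF xy(2)]] .
      then show "x = y" by auto
    qed
    show "(\<lambda>j. d (3 * j)) ` bad_right \<subseteq> spoilt_right"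
    proof (rule image_subsetI)
      fix j assume "j \<in> bad_right"
      then have j: "j \<in> {1..q}" "\<not> \<sigma> (d (3 * j)) \<noteq> 1" by (auto simp: bad_right_def)
      then show "d (3 * j) \<in> spoilt_right"
        unfolding spoilt_right_def using d_in[OF range(3)[OF j(1)]] seat_d[OF range(3)[OF j(1)]]
        by blast
    qed
    show "finite spoilt_right" by (simp add: spoilt_right_def)
  qed
  moreover have "card {1..q} \<le> card (good \<union> bad_left \<union> bad_right)"
    by (rule card_mono) (auto simp: good_def bad_left_def bad_right_def)
  moreover have "card (good \<union> bad_left \<union> bad_right) \<le> card good + card bad_left + card bad_right"
    by (meson add_le_mono card_Un_le le_trans order_refl)
  ultimately show ?thesis unfolding \<nu>_def by simp
qed

lemma trap_lower_bound:
  "q \<le> \<nu> n (trap_seating n \<sigma>) \<sigma> \<or>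
   (\<exists>t\<in>{1..n}. int n \<le> 2 * int (\<nu> n (trap_seating n \<sigma>) \<sigma>) + \<bar>\<Sum>i=1..t. \<sigma> i\<bar> + 1)"
proof -
  consider "spoilt_left = {}" "spoilt_right = {}" | "spoilt_left \<noteq> {}" "spoilt_right = {}"
    | "spoilt_right \<noteq> {}" "spoilt_left = {}"
    using spoilt_one_sided by blast
  then show ?thesis
  proof cases
    case 1
    then show ?thesis using benches_le_trapped_plus_spoilt by simp
  next
    case 2
    obtain t where "t \<in> {1..n}" "card {i\<in>{1..t}. \<sigma> i \<noteq> 1} + 2 * q + 1 =
        card {i\<in>{1..t}. \<sigma> i = 1} + n + 2 * card spoilt_left"
      using spoilt_left_bound[OF 2(1)] by blast
    moreover have "q \<le> \<nu> n (trap_seating n \<sigma>) \<sigma> + card spoilt_left"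
      using benches_le_trapped_plus_spoilt 2(2) by simp
    \<comment> \<open>Eliminating \<open>card spoilt_left\<close> between the two relations leaves
      twice the napkinless count, the partial sum up to sign, and the extra 1.\<close>
    ultimately show ?thesis
      using sum_preferences[OF \<sigma>, of t] by (intro disjI2 bexI[of _ t]) auto
  next
    case 3
    obtain t where "t \<in> {1..n}" "card {i\<in>{1..t}. \<sigma> i = 1} + 2 * q + 1 =
        card {i\<in>{1..t}. \<sigma> i \<noteq> 1} + n + 2 * card spoilt_right"
      using spoilt_right_bound[OF 3(1)] by blast
    moreover have "q \<le> \<nu> n (trap_seating n \<sigma>) \<sigma> + card spoilt_right"
      using benches_le_trapped_plus_spoilt 3(2) by simp
    ultimately show ?thesis
      using sum_preferences[OF \<sigma>, of t] by (intro disjI2 bexI[of _ t]) auto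
  qed
qed

end

section \<open>Optimality and the event of few napkinless diners\<close>

lemma trap_optimal:
  assumes "n \<ge> 1" "\<sigma> \<in> preference_orders n"
  shows "\<nu> n (trap_seating n \<sigma>) \<sigma> = \<nu>_max n \<sigma>"
proof -
  interpret trap_setting n \<sigma> by unfold_locales (rule assms(2))
  have "\<nu> n w \<sigma> \<le> \<nu> n (trap_seating n \<sigma>) \<sigma>" if w: "w \<in> seating_orders n" for w
    using trap_lower_bound
  proof
    assume "q \<le> \<nu> n (trap_seating n \<sigma>) \<sigma>"
    then show ?thesis using napkinless_upper_bounds(1)[OF w assms(2)] by linarith
  next
    assume "\<exists>t\<in>{1..n}. int n \<le> 2 * int (\<nu> n (trap_seating n \<sigma>) \<sigma>) + \<bar>\<Sum>i=1..t. \<sigma> i\<bar> + 1"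
    then obtain t where "t \<le> n" "int n \<le> 2 * int (\<nu> n (trap_seating n \<sigma>) \<sigma>) + \<bar>\<Sum>i=1..t. \<sigma> i\<bar> + 1"
      by auto
    \<comment> \<open>At the same \<open>t\<close> the two bounds differ by 1 while the counts enter
      with factor 2, so integrality closes the gap.\<close>
    then show ?thesis using napkinless_upper_bounds(2)[OF w assms(2), of t] by linarith
  qed
  moreover have "finite (seating_orders n)"
    unfolding seating_orders_def by (rule finite_subset[OF _ finite_permutations[of "{1..n}"]]) auto
  ultimately show ?thesis
    unfolding \<nu>_max_def using trap_seating_in_seating_orders[OF assms(1)]
    by (intro Max_eqI[symmetric]) auto
qed

text \<open>Both bounds together determine \<open>\<nu>\<close> up to the parity of \<open>n - |S\<^sub>t|\<close>, which suffices to
  describe the event \<open>\<nu> \<le> k\<close>.\<close>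

lemma trap_le_iff:
  assumes "n \<ge> 1" "\<sigma> \<in> preference_orders n" "k < n div 3"
  shows "\<nu> n (trap_seating n \<sigma>) \<sigma> \<le> k \<longleftrightarrow> (\<exists>t\<le>n. int n - 1 - 2 * int k \<le> \<bar>\<Sum>i=1..t. \<sigma> i\<bar>)"
proof
  interpret trap_setting n \<sigma> by unfold_locales (rule assms(2))
  assume le: "\<nu> n (trap_seating n \<sigma>) \<sigma> \<le> k"
  then obtain t where "t \<in> {1..n}" "int n \<le> 2 * int (\<nu> n (trap_seating n \<sigma>) \<sigma>) + \<bar>\<Sum>i=1..t. \<sigma> i\<bar> + 1"
    using trap_lower_bound assms(3) by auto
  with le show "\<exists>t\<le>n. int n - 1 - 2 * int k \<le> \<bar>\<Sum>i=1..t. \<sigma> i\<bar>"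
    by (intro exI[of _ t]) auto
next
  assume "\<exists>t\<le>n. int n - 1 - 2 * int k \<le> \<bar>\<Sum>i=1..t. \<sigma> i\<bar>"
  then obtain t where "t \<le> n" "int n - 1 - 2 * int k \<le> \<bar>\<Sum>i=1..t. \<sigma> i\<bar>" by blast
  then show "\<nu> n (trap_seating n \<sigma>) \<sigma> \<le> k"
    using napkinless_upper_bounds(2)[OF trap_seating_in_seating_orders[OF assms(1)] assms(2), of t \<sigma>]
    by linarith
qed

section \<open>Counting walks that reach a given height\<close>

text \<open>Lists make it easy to split off the first step. Time \<open>t = 0\<close> is included,
  so a target \<open>h \<le> 0\<close> is always reached.\<close>

definition reaching_walks :: "nat \<Rightarrow> int \<Rightarrow> int list set" where
  "reaching_walks n h =
     {xs. set xs \<subseteq> {1, -1} \<and> length xs = n \<and> (\<exists>t\<le>n. h \<le> sum_list (take t xs))}"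

lemma finite_reaching_walks: "finite (reaching_walks n h)"
  by (rule finite_subset[OF _ finite_lists_length_eq[of "{1, -1}" n]])
    (auto simp: reaching_walks_def)

lemma card_reaching_walks_nonpos:
  assumes "h \<le> 0"
  shows "card (reaching_walks n h) = 2 ^ n"
proof -
  have "reaching_walks n h = {xs. set xs \<subseteq> {1, -1} \<and> length xs = n}"
    using assms by (auto simp: reaching_walks_def intro!: exI[of _ 0])
  then show ?thesis by (simp add: card_lists_length_eq numeral_2_eq_2)
qed

lemma reaching_walks_too_high:
  assumes "int n < h"
  shows "reaching_walks n h = {}"
proof -
  have height: "sum_list ys \<le> int (length ys)" if "set ys \<subseteq> {1, -1}" for ys :: "int list"
    using that by (induction ys) auto
  have "\<not> h \<le> sum_list (take t xs)" if xs: "set xs \<subseteq> {1, -1}" "length xs = n"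
    for t and xs :: "int list"
  proof -
    have "set (take t xs) \<subseteq> {1, -1}" using xs(1) set_take_subset[of t xs] by blast
    then have "sum_list (take t xs) \<le> int (length (take t xs))" by (rule height)
    also have "\<dots> \<le> int n" using xs(2) by simp
    finally show ?thesis using assms by linarith
  qed
  then show ?thesis unfolding reaching_walks_def by blast
qed

text \<open>A positive target is not reached at time 0, so the first step can be removed and the
  target shifted by it.\<close>

lemma reaching_walks_Suc:
  assumes "h > 0"
  shows "reaching_walks (Suc n) h =
    (#) 1 ` reaching_walks n (h - 1) \<union> (#) (-1) ` reaching_walks n (h + 1)"
proof -
  have step: "x # xs \<in> reaching_walks (Suc n) h \<longleftrightarrow> x \<in> {1, -1} \<and> xs \<in> reaching_walks n (h - x)"
    for x xs
  proof -
    have "(\<exists>t\<le>Suc n. h \<le> sum_list (take t (x # xs))) \<longleftrightarrow>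
        (\<exists>t\<le>n. h \<le> sum_list (take (Suc t) (x # xs)))"
    proof
      assume "\<exists>t\<le>Suc n. h \<le> sum_list (take t (x # xs))"
      then obtain t where "t \<le> Suc n" "h \<le> sum_list (take t (x # xs))" by blast
      then show "\<exists>t\<le>n. h \<le> sum_list (take (Suc t) (x # xs))"
        using assms by (cases t) auto
    next
      assume "\<exists>t\<le>n. h \<le> sum_list (take (Suc t) (x # xs))"
      then show "\<exists>t\<le>Suc n. h \<le> sum_list (take t (x # xs))"
        by (meson Suc_le_mono)
    qed
    then show ?thesis by (auto simp: reaching_walks_def algebra_simps)
  qed
  show ?thesis
  proof (rule set_eqI)
    fix ys
    show "ys \<in> reaching_walks (Suc n) h \<longleftrightarrow>
      ys \<in> (#) 1 ` reaching_walks n (h - 1) \<union> (#) (-1) ` reaching_walks n (h + 1)"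
    proof (cases ys)
      case Nil
      then show ?thesis by (auto simp: reaching_walks_def)
    next
      case (Cons x xs)
      then show ?thesis by (auto simp: step image_iff)
    qed
  qed
qed

lemma sum_choose_Suc:
  "(\<Sum>j\<le>Suc k. Suc n choose j) = (\<Sum>j\<le>Suc k. n choose j) + (\<Sum>j\<le>k. n choose j)"
  by (induction k) (auto simp: choose_reduce_nat)

text \<open>The value is twice the number of walks with at most \<open>k\<close> down steps, as the
  reflection principle predicts. A first step up keeps \<open>k\<close>, a first step down lowers it
  by one, and the two counts add up by Pascal's rule.\<close>

lemma card_reaching_walks:
  assumes "h = int n - 1 - 2 * int k" "h \<ge> 0"
  shows "card (reaching_walks n h) = 2 * (\<Sum>j\<le>k. n choose j)"
  using assms
proof (induction n arbitrary: h k)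
  case 0
  then show ?case by simp
next
  case (Suc n)
  show ?case
  proof (cases "h = 0")
    case True
    \<comment> \<open>All walks count here, and the sum covers the lower half of a binomial row of
      odd index.\<close>
    then have "n = 2 * k" using Suc.prems by linarith
    with True show ?thesis
      using binomial_r_part_sum[of k] by (simp add: card_reaching_walks_nonpos)
  next
    case False
    then have "h > 0" using Suc.prems(2) by simp
    have "card (reaching_walks (Suc n) h) =
        card ((#) 1 ` reaching_walks n (h - 1)) + card ((#) (-1) ` reaching_walks n (h + 1))"
      unfolding reaching_walks_Suc[OF \<open>h > 0\<close>]
      by (rule card_Un_disjoint) (auto simp: finite_reaching_walks)
    also have "\<dots> = card (reaching_walks n (h - 1)) + card (reaching_walks n (h + 1))"
      by (simp add: card_image)
    also have "card (reaching_walks n (h - 1)) = 2 * (\<Sum>j\<le>k. n choose j)"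
      using Suc.prems \<open>h > 0\<close> by (intro Suc.IH) auto
    finally have *: "card (reaching_walks (Suc n) h) =
      2 * (\<Sum>j\<le>k. n choose j) + card (reaching_walks n (h + 1))" .
    show ?thesis
    proof (cases k)
      case 0
      \<comment> \<open>For \<open>k = 0\<close> the target after a down step is
        \<open>n + 1\<close>, out of reach in \<open>n\<close> steps.\<close>
      then have "reaching_walks n (h + 1) = {}"
        using Suc.prems by (intro reaching_walks_too_high) auto
      with 0 show ?thesis using * by simp
    next
      case (Suc k')
      have "card (reaching_walks n (h + 1)) = 2 * (\<Sum>j\<le>k'. n choose j)"
        using Suc.prems Suc by (intro Suc.IH) auto
      then show ?thesis using * sum_choose_Suc[of n k'] Suc by simp
    qed
  qed
qed

section \<open>Preference orders as walks\<close>

lemma card_preference_orders: "card (preference_orders n) = 2 ^ n"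
  by (simp add: preference_orders_def card_PiE numeral_2_eq_2)

lemma finite_preference_orders: "finite (preference_orders n)"
  by (auto simp: preference_orders_def intro: finite_PiE)

lemma preference_ordersD:
  "\<sigma> \<in> preference_orders n \<Longrightarrow> i \<in> {1..n} \<Longrightarrow> \<sigma> i = 1 \<or> \<sigma> i = -1"
  by (auto simp: preference_orders_def PiE_iff)

text \<open>The sign \<open>c\<close> lets one bijection handle both barriers, \<open>h\<close> and
  \<open>-h\<close>. Since \<open>c * c = 1\<close>, the same factor undoes itself in the inverse
  map.\<close>

lemma card_preferences_reaching:
  fixes c :: int
  assumes c: "c = 1 \<or> c = -1"
  shows "card {\<sigma> \<in> preference_orders n. \<exists>t\<le>n. h \<le> c * (\<Sum>i=1..t. \<sigma> i)} = card (reaching_walks n h)"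
proof (rule bij_betw_same_card)
  let ?f = "\<lambda>\<sigma>. map (\<lambda>i. c * \<sigma> i) [1..<Suc n]"
  \<comment> \<open>Diners count from 1 and list positions from 0; \<open>undefined\<close> outside
    the range keeps the function extensional.\<close>
  let ?g = "\<lambda>xs i. if i \<in> {1..n} then c * xs ! (i - 1) else undefined"
  have prefix_sum: "sum_list (take t (?f \<sigma>)) = c * (\<Sum>i=1..t. \<sigma> i)" if "t \<le> n" for t and \<sigma> :: "nat \<Rightarrow> int"
  proof -
    have "sum_list (take t (?f \<sigma>)) = sum_list (map (\<lambda>i. c * \<sigma> i) [1..<Suc t])"
      using that by (simp add: take_map take_upt del: upt_Suc)
    also have "\<dots> = (\<Sum>i=1..t. c * \<sigma> i)"
      by (simp add: interv_sum_list_conv_sum_set_nat atLeastLessThanSuc_atLeastAtMost del: upt_Suc)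
    finally show ?thesis by (simp add: sum_distrib_left)
  qed
  have cc: "c * (c * x) = x" for x using c by auto
  show "bij_betw ?f {\<sigma> \<in> preference_orders n. \<exists>t\<le>n. h \<le> c * (\<Sum>i=1..t. \<sigma> i)} (reaching_walks n h)"
  proof (rule bij_betw_byWitness[where f' = ?g])
    show "\<forall>\<sigma>\<in>{\<sigma> \<in> preference_orders n. \<exists>t\<le>n. h \<le> c * (\<Sum>i=1..t. \<sigma> i)}. ?g (?f \<sigma>) = \<sigma>"
      by (auto simp: preference_orders_def PiE_iff extensional_def cc fun_eq_iff simp del: upt_Suc)
    show fg: "\<forall>xs\<in>reaching_walks n h. ?f (?g xs) = xs"
      by (auto simp: reaching_walks_def cc intro!: nth_equalityI simp del: upt_Suc)
    show "?f ` {\<sigma> \<in> preference_orders n. \<exists>t\<le>n. h \<le> c * (\<Sum>i=1..t. \<sigma> i)} \<subseteq> reaching_walks n h"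
    proof (rule image_subsetI)
      fix \<sigma> assume \<sigma>: "\<sigma> \<in> {\<sigma> \<in> preference_orders n. \<exists>t\<le>n. h \<le> c * (\<Sum>i=1..t. \<sigma> i)}"
      have "set (?f \<sigma>) \<subseteq> {1, -1}"
        using \<sigma> c preference_ordersD[of \<sigma> n] by fastforce
      moreover have "\<exists>t\<le>n. h \<le> sum_list (take t (?f \<sigma>))"
        using \<sigma> prefix_sum by auto
      ultimately show "?f \<sigma> \<in> reaching_walks n h"
        unfolding reaching_walks_def by (simp del: upt_Suc)
    qed
    show "?g ` reaching_walks n h \<subseteq> {\<sigma> \<in> preference_orders n. \<exists>t\<le>n. h \<le> c * (\<Sum>i=1..t. \<sigma> i)}"
    proof (rule image_subsetI)
      fix xs assume xs: "xs \<in> reaching_walks n h"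
      then have len: "length xs = n" and set: "set xs \<subseteq> {1, -1}"
        and ex: "\<exists>t\<le>n. h \<le> sum_list (take t xs)"
        by (auto simp: reaching_walks_def)
      have "c * xs ! (i - 1) \<in> {1, -1}" if "i \<in> {1..n}" for i
      proof -
        have "xs ! (i - 1) \<in> set xs" using that len by (intro nth_mem) auto
        with set c show ?thesis by auto
      qed
      then have "?g xs \<in> preference_orders n"
        unfolding preference_orders_def by (intro PiE_I) (auto simp del: insert_iff)
      moreover have "\<exists>t\<le>n. h \<le> c * (\<Sum>i=1..t. ?g xs i)"
        using ex prefix_sum[of _ "?g xs"] bspec[OF fg xs] by metis
      ultimately show "?g xs \<in> {\<sigma> \<in> preference_orders n. \<exists>t\<le>n. h \<le> c * (\<Sum>i=1..t. \<sigma> i)}"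
        by blast
    qed
  qed
qed

lemma partial_sum_diff_le:
  assumes "\<sigma> \<in> preference_orders n" "t \<le> u" "u \<le> n"
  shows "\<bar>(\<Sum>i=1..u. \<sigma> i) - (\<Sum>i=1..t. \<sigma> i)\<bar> \<le> int u - int t"
  using assms(2,3)
proof (induction u rule: dec_induct)
  case (step u)
  have "\<sigma> (Suc u) = 1 \<or> \<sigma> (Suc u) = -1"
    using preference_ordersD[OF assms(1)] step by auto
  with step show ?case by auto
qed simp

text \<open>Reaching both \<open>h\<close> and \<open>-h\<close> takes at least \<open>3 h\<close> steps.\<close>

lemma not_reaching_both:
  assumes \<sigma>: "\<sigma> \<in> preference_orders n" and h: "int n < 3 * h" and tu: "t \<le> n" "u \<le> n"
    and "h \<le> (\<Sum>i=1..t. \<sigma> i)" "h \<le> - (\<Sum>i=1..u. \<sigma> i)"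
  shows False
proof (cases "t \<le> u")
  case True
  then show False
    using partial_sum_diff_le[OF \<sigma>, of t u] partial_sum_diff_le[OF \<sigma>, of 0 t] assms by simp
next
  case False
  then show False
    using partial_sum_diff_le[OF \<sigma>, of u t] partial_sum_diff_le[OF \<sigma>, of 0 u] assms by simp
qed

section \<open>The distribution of the number of napkinless diners\<close>

text \<open>The event splits into reaching \<open>h\<close> and reaching \<open>-h\<close>. These
  are disjoint and equally likely, which doubles the factor 2 of a single barrier.\<close>

lemma card_trap_le:
  assumes "n \<ge> 1" "k < n div 3"
  shows "card {\<sigma> \<in> preference_orders n. \<nu> n (trap_seating n \<sigma>) \<sigma> \<le> k} = 4 * (\<Sum>j\<le>k. n choose j)"
proof -
  define h where "h = int n - 1 - 2 * int k"
  \<comment> \<open>From \<open>6 * k \<le> 2 * n - 6\<close> follows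
    \<open>3 * h \<ge> n + 3\<close>, enough to exclude reaching both barriers.\<close>
  have "3 * Suc k \<le> n" using assms(2) by presburger
  then have h: "int n < 3 * h" "0 \<le> h" unfolding h_def by auto
  define W where "W c = {\<sigma> \<in> preference_orders n. \<exists>t\<le>n. h \<le> c * (\<Sum>i=1..t. \<sigma> i)}" for c
  have fin: "finite (W c)" for c
    unfolding W_def by (simp add: finite_preference_orders)
  have "{\<sigma> \<in> preference_orders n. \<nu> n (trap_seating n \<sigma>) \<sigma> \<le> k} = W 1 \<union> W (-1)"
  proof -
    have "h \<le> \<bar>x\<bar> \<longleftrightarrow> h \<le> 1 * x \<or> h \<le> -1 * x" for x
      by (auto simp: abs_if)
    then show ?thesis
      using trap_le_iff[OF assms(1) _ assms(2)] unfolding W_def h_def[symmetric] by blast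
  qed
  moreover have "W 1 \<inter> W (-1) = {}"
    using not_reaching_both[OF _ h(1)] by (auto simp: W_def)
  moreover have "card (W c) = 2 * (\<Sum>j\<le>k. n choose j)" if "c = 1 \<or> c = -1" for c
    unfolding W_def card_preferences_reaching[OF that] by (rule card_reaching_walks[OF h_def h(2)])
  ultimately show ?thesis by (simp add: card_Un_disjoint fin)
qed

text \<open>Below \<open>n div 3\<close> the counts are differences of consecutive cumulative
  counts; the value \<open>n div 3\<close> receives all remaining orders.\<close>

lemma card_trap_eq:
  assumes "n \<ge> 3"
  shows "real (card {\<sigma> \<in> preference_orders n. \<nu> n (trap_seating n \<sigma>) \<sigma> = k}) = napkinless_count n k"
proof -
  define X where "X \<sigma> = \<nu> n (trap_seating n \<sigma>) \<sigma>" for \<sigma>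
  define U where "U = preference_orders n"
  have fin: "finite U" by (simp add: U_def finite_preference_orders)
  have n: "n \<ge> 1" using assms by simp
  have le: "card {\<sigma> \<in> U. X \<sigma> \<le> k} = 4 * (\<Sum>j\<le>k. n choose j)" if "k < n div 3" for k
    unfolding X_def U_def by (rule card_trap_le[OF n that])
  have X_le: "X \<sigma> \<le> n div 3" if "\<sigma> \<in> U" for \<sigma>
    using napkinless_upper_bounds(1)[OF trap_seating_in_seating_orders[OF n], of \<sigma> \<sigma>] that
    unfolding X_def U_def by auto
  have step: "card {\<sigma> \<in> U. X \<sigma> \<le> Suc m} = card {\<sigma> \<in> U. X \<sigma> \<le> m} + card {\<sigma> \<in> U. X \<sigma> = Suc m}" for m
  proof -
    have "{\<sigma> \<in> U. X \<sigma> \<le> Suc m} = {\<sigma> \<in> U. X \<sigma> \<le> m} \<union> {\<sigma> \<in> U. X \<sigma> = Suc m}" by auto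
    then show ?thesis by (simp add: card_Un_disjoint[symmetric] fin)
      (rule card_Un_disjoint; auto simp: fin)
  qed
  consider "k < n div 3" "k = 0" | m where "k < n div 3" "k = Suc m" | "k = n div 3" | "k > n div 3"
    by (metis linorder_neqE_nat not0_implies_Suc)
  then have "real (card {\<sigma> \<in> U. X \<sigma> = k}) = napkinless_count n k"
  proof cases
    case 1
    then show ?thesis using le[of 0] by (simp add: napkinless_count_def)
  next
    case 2
    then show ?thesis using le[of k] le[of m] step[of m] by (simp add: napkinless_count_def)
  next
    case 3
    obtain m where m: "n div 3 = Suc m" using assms by (cases "n div 3") auto
    have "{\<sigma> \<in> U. X \<sigma> \<le> Suc m} = U" using X_le m by auto
    then have "2 ^ n = 4 * (\<Sum>j\<le>m. n choose j) + card {\<sigma> \<in> U. X \<sigma> = Suc m}"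
      using step[of m] le[of m] m by (simp add: U_def card_preference_orders)
    then have "real (2 ^ n) = real (4 * (\<Sum>j\<le>m. n choose j) + card {\<sigma> \<in> U. X \<sigma> = Suc m})"
      by (rule arg_cong)
    then show ?thesis using 3 m by (simp add: napkinless_count_def lessThan_Suc_atMost)
  next
    case 4
    then have "{\<sigma> \<in> U. X \<sigma> = k} = {}" using X_le by fastforce
    then show ?thesis using 4 by (simp only: napkinless_count_def) simp
  qed
  then show ?thesis by (simp add: X_def U_def)
qed

lemma preference_orders_nonempty: "preference_orders n \<noteq> {}"
  using card_preference_orders[of n] by auto

section \<open>Probabilities, expectation and limit\<close>

lemma prob_napkinless:
  assumes "n \<ge> 3"
  shows "measure_pmf.prob (random_preference_order n) {\<sigma>. \<nu> n (trap_seating n \<sigma>) \<sigma> = k}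
    = napkinless_count n k / 2 ^ n"
proof -
  have "preference_orders n \<inter> {\<sigma>. \<nu> n (trap_seating n \<sigma>) \<sigma> = k} =
      {\<sigma> \<in> preference_orders n. \<nu> n (trap_seating n \<sigma>) \<sigma> = k}" by auto
  then show ?thesis
    using card_trap_eq[OF assms, of k]
    by (simp add: random_preference_order_def measure_pmf_of_set preference_orders_nonempty
        finite_preference_orders card_preference_orders)
qed

lemma expected_napkinless_eq:
  assumes "n \<ge> 3"
  shows "expected_napkinless n = real (n div 3)
    - 1 / 2 ^ (n - 2) * (\<Sum>k<n div 3. (real (n div 3) - real k) * real (n choose k))"
proof -
  define q where "q = n div 3"
  define X where "X \<sigma> = \<nu> n (trap_seating n \<sigma>) \<sigma>" for \<sigma>
  define U where "U = preference_orders n"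
  have fin: "finite U" by (simp add: U_def finite_preference_orders)
  have n: "n \<ge> 1" using assms by simp
  have X_le: "X ` U \<subseteq> {..q}"
  proof (rule image_subsetI)
    fix \<sigma> assume "\<sigma> \<in> U"
    then show "X \<sigma> \<in> {..q}"
      using napkinless_upper_bounds(1)[OF trap_seating_in_seating_orders[OF n], of \<sigma> \<sigma>]
      unfolding X_def U_def q_def by auto
  qed
  have "(\<Sum>\<sigma>\<in>U. real (X \<sigma>)) = (\<Sum>k\<le>q. \<Sum>\<sigma> \<in> {\<sigma> \<in> U. X \<sigma> = k}. real (X \<sigma>))"
    using sum.group[OF fin _ X_le, of "\<lambda>\<sigma>. real (X \<sigma>)"] by simp
  also have "\<dots> = (\<Sum>k\<le>q. napkinless_count n k * real k)"
    using card_trap_eq[OF assms] by (intro sum.cong) (auto simp: X_def U_def)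
  also have "\<dots> = (\<Sum>k<q. napkinless_count n k * real k) + napkinless_count n q * real q"
    by (simp add: lessThan_Suc_atMost[symmetric])
  also have "(\<Sum>k<q. napkinless_count n k * real k) = (\<Sum>k<q. 4 * real (n choose k) * real k)"
    by (intro sum.cong) (auto simp: napkinless_count_def q_def)
  also have "napkinless_count n q = 2 ^ n - 4 * (\<Sum>i<q. real (n choose i))"
    by (simp add: napkinless_count_def q_def)
  finally have "(\<Sum>\<sigma>\<in>U. real (X \<sigma>)) =
      2 ^ n * real q - 4 * (\<Sum>k<q. (real q - real k) * real (n choose k))"
    by (simp add: algebra_simps sum_subtractf sum_distrib_left sum_distrib_right)
  moreover have "expected_napkinless n = (\<Sum>\<sigma>\<in>U. real (X \<sigma>)) / 2 ^ n"
    by (simp add: expected_napkinless_def random_preference_order_def integral_pmf_of_set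
        preference_orders_nonempty finite_preference_orders card_preference_orders X_def U_def)
  \<comment> \<open>This turns the factor \<open>4 / 2 ^ n\<close> into
    \<open>1 / 2 ^ (n - 2)\<close>.\<close>
  moreover have "(2::real) ^ n = 4 * 2 ^ (n - 2)"
    using assms by (simp add: power_diff)
  ultimately show ?thesis by (simp add: q_def field_simps)
qed

text \<open>Since \<open>q - k \<le> 2\<^bsup>q - k\<^esup>\<close>, the error is at most \<open>4 \<cdot> 2\<^sup>q (3/2)\<^sup>n / 2\<^sup>n\<close>.\<close>

lemma expected_napkinless_error:
  assumes "n \<ge> 3"
  shows "\<bar>expected_napkinless n - real (n div 3)\<bar> \<le> 4 * (27 / 32) ^ (n div 3)"
proof -
  define q where "q = n div 3"
  define S where "S = (\<Sum>k<q. (real q - real k) * real (n choose k))"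
  have "S \<le> (\<Sum>k<q. 2 ^ q * (real (n choose k) * (1 / 2) ^ k))"
    unfolding S_def
  proof (rule sum_mono)
    fix k assume "k \<in> {..<q}"
    then have k: "k \<le> q" by simp
    have "real q - real k \<le> 2 ^ (q - k)"
      using k less_imp_le[OF of_nat_less_two_power[of "q - k", where ?'a = real]] by (simp add: of_nat_diff)
    also have "(2::real) ^ (q - k) = 2 ^ q * (1 / 2) ^ k"
      using k by (simp add: power_diff power_one_over field_simps)
    finally have "(real q - real k) * real (n choose k) \<le> 2 ^ q * (1 / 2) ^ k * real (n choose k)"
      by (rule mult_right_mono) simp
    then show "(real q - real k) * real (n choose k) \<le> 2 ^ q * (real (n choose k) * (1 / 2) ^ k)"
      by (simp add: mult_ac)
  qed
  \<comment> \<open>Extending the range to \<open>n\<close> completes the binomial expansion of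
    \<open>(1 / 2 + 1) ^ n\<close>.\<close>
  also have "\<dots> \<le> (\<Sum>k\<le>n. 2 ^ q * (real (n choose k) * (1 / 2) ^ k))"
    by (rule sum_mono2) (auto simp: q_def)
  also have "\<dots> = 2 ^ q * (3 / 2) ^ n"
    using binomial_ring[of "1 / 2 :: real" 1 n] by (simp add: sum_distrib_left)
  finally have S: "S \<le> 2 ^ q * (3 / 2) ^ n" .
  have "S \<ge> 0" unfolding S_def by (intro sum_nonneg) auto
  have "(2::real) ^ n = 4 * 2 ^ (n - 2)"
    using assms by (simp add: power_diff)
  then have "\<bar>expected_napkinless n - real q\<bar> = 4 * S / 2 ^ n"
    unfolding expected_napkinless_eq[OF assms] using \<open>S \<ge> 0\<close> by (simp add: S_def q_def)
  also have "\<dots> \<le> 4 * (2 ^ q * (3 / 2) ^ n) / 2 ^ n"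
    using S by (intro divide_right_mono mult_left_mono) auto
  also have "\<dots> = 4 * (2 ^ q * (3 / 4) ^ n)"
    by (simp add: power_divide flip: power_mult_distrib)
  \<comment> \<open>Here \<open>3 * q \<le> n\<close> and the base is below 1; the rate is then
    \<open>2 * (3 / 4) ^ 3 = 27 / 32\<close>.\<close>
  also have "\<dots> \<le> 4 * (2 ^ q * (3 / 4) ^ (3 * q))"
    by (intro mult_left_mono power_decreasing) (auto simp: q_def)
  also have "\<dots> = 4 * (27 / 32) ^ q"
    by (simp add: power_mult power3_eq_cube flip: power_mult_distrib)
  finally show ?thesis unfolding q_def .
qed

lemma expected_napkinless_limit:
  "(\<lambda>m. expected_napkinless m - real (m div 3)) \<longlonglongrightarrow> 0"
proof (rule Lim_null_comparison)
  show "\<forall>\<^sub>F m in sequentially.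
      norm (expected_napkinless m - real (m div 3)) \<le> 4 * (27 / 32) ^ (m div 3)"
    using eventually_ge_at_top[of 3]
    by eventually_elim (simp only: real_norm_def expected_napkinless_error)
  have "filterlim (\<lambda>m::nat. m div 3) at_top at_top"
    by (rule filterlim_at_top_div_const_nat) simp
  moreover have "(\<lambda>k. (27 / 32 :: real) ^ k) \<longlonglongrightarrow> 0"
    by (rule LIMSEQ_realpow_zero) auto
  ultimately have "(\<lambda>m. (27 / 32 :: real) ^ (m div 3)) \<longlonglongrightarrow> 0"
    by (rule filterlim_compose[rotated])
  then show "(\<lambda>m. 4 * (27 / 32 :: real) ^ (m div 3)) \<longlonglongrightarrow> 0"
    by (rule tendsto_mult_right_zero)
qed

theorem theorem1p1:
  fixes n :: nat
  assumes "n \<ge> 3"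
  shows
    "(\<forall>k. measure_pmf.prob (random_preference_order n) {\<sigma>. \<nu> n (trap_seating n \<sigma>) \<sigma> = k}
            = napkinless_count n k / 2 ^ n)
     \<and> expected_napkinless n
         = real (n div 3)
           - 1 / 2 ^ (n - 2) * (\<Sum>k<n div 3. (real (n div 3) - real k) * real (n choose k))
     \<and> (\<lambda>m. expected_napkinless m - real (m div 3)) \<longlonglongrightarrow> 0
     \<and> (\<forall>\<sigma> \<in> preference_orders n. \<nu> n (trap_seating n \<sigma>) \<sigma> = \<nu>_max n \<sigma>)"
  using prob_napkinless[OF assms] expected_napkinless_eq[OF assms] expected_napkinless_limit
    trap_optimal[of n] assms
  by auto

end
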